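(* Let $G$ be the simple complex algebraic group of type $\mathsf F_4$. There are exactly $266$ spherical systems of $G$ (up to isomorphism): $16$ of rank $0$, $41$ of rank $1$, $61$ of rank $2$, $77$ of rank $3$ and $71$ of rank $4$.
   Context: Let $R$ be the root system of type $\mathsf F_4$ with simple roots $S=\{\alpha_1,\alpha_2,\alpha_3,\alpha_4\}$ numbered as in Bourbaki ($\alpha_1,\alpha_2$ long, $\alpha_3,\alpha_4$ short, $\langle\alpha_2^\vee,\alpha_3\rangle=-1$, $\langle\alpha_3^\vee,\alpha_2\rangle=-2$). The set $\Sigma(G)$ of spherical roots of $G$ consists of: $\alpha_i$ and $2\alpha_i$ ($i=1,2,3,4$); $\alpha_1+\alpha_3$, $\alpha_1+\alpha_4$, $\alpha_2+\alpha_4$; $\alpha_1+\alpha_2$, $\alpha_3+\alpha_4$; $\alpha_2+\alpha_3$, $2\alpha_2+2\alpha_3$; $\alpha_1+\alpha_2+\alpha_3$, $2\alpha_1+2\alpha_2+2\alpha_3$, $\alpha_1+2\alpha_2+3\alpha_3$; $\alpha_2+2\alpha_3+\alpha_4$; $\alpha_1+2\alpha_2+3\alpha_3+2\alpha_4$. For $\sigma\in\Sigma(G)$ let $S^p(\sigma)$ be the set of simple roots orthogonal to $\sigma$, $\mathrm{supp}(\sigma)\subset S$ its support, and let $S^{pp}(\sigma)$ be: $S^p(\sigma)\cap\mathrm{supp}(\sigma)\setminus\{\alpha_3\}$ if $\sigma=\alpha_2+\alpha_3$ or $\sigma=\alpha_1+\alpha_2+\alpha_3$; $S^p(\sigma)\cap\mathrm{supp}(\sigma)\setminus\{\alpha_4\}$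 if $\sigma=\alpha_2+2\alpha_3+\alpha_4$; $S^p(\sigma)\cap\mathrm{supp}(\sigma)$ otherwise. A couple $(\sigma,S^p)$, $\sigma\in\Sigma(G)$, $S^p\subset S$, is compatible if $S^{pp}(\sigma)\subset S^p\subset S^p(\sigma)$. A spherical system of $G$ is a triplet $(\Sigma,S^p,\mathbf A)$ with $\Sigma\subset\Sigma(G)$ without proportional elements, $S^p\subset S$, and $\mathbf A$ a finite set with a map $c:\mathbf A\to\mathrm{Hom}_{\mathbb Z}(\mathbb Z\Sigma,\mathbb Z)$ (viewed as a pairing $c:\mathbf A\times\Sigma\to\mathbb Z$; i.e. $\mathbf A$ is a finite multi-subset of $(\mathbb Z\Sigma)^\ast$), such that: (S) $(\sigma,S^p)$ is compatible for all $\sigma\in\Sigma$; (A1) for all $\delta\in\mathbf A$, $\sigma\in\Sigma$, $c(\delta,\sigma)\le1$, and $c(\delta,\sigma)=1$ implies $\sigma\in S\cap\Sigma$; (A2) for all $\alpha\in S\cap\Sigma$, the set $\mathbf A(\alpha)=\{\delta\in\mathbf A:c(\delta,\alpha)=1\}$ has exactly two elements $\delta^+_\alpha,\delta^-_\alpha$, and $c(\delta^+_\alpha,\sigma)+c(\delta^-_\alpha,\sigma)=\langle\alpha^\vee,\sigma\rangle$ for all $\sigma\in\Sigma$; (A3) $\mathbf A=\bigcup_{\alpha\in S\cap\Sigma}\mathbf A(\alpha)$; ($\Sigma$1) if $2\alpha\in\Sigma\cap2S$, then $\langle\alpha^\vee,\sigma\rangle/2$ is a non-positive integer for all $\sigma\in\Sigma\setminus\{2\alpha\}$;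 ($\Sigma$2) if $\alpha+\beta\in\Sigma$ with $\alpha,\beta\in S$, $\alpha\perp\beta$, then $\langle\alpha^\vee,\sigma\rangle=\langle\beta^\vee,\sigma\rangle$ for all $\sigma\in\Sigma$. The rank of the system is $\mathrm{card}(\Sigma)$. Two systems are isomorphic if they have the same $\Sigma$ and $S^p$ and there is a bijection between the sets $\mathbf A$ compatible with the maps $c$. *)

theory Defs
  imports "HOL-Analysis.Analysis" "HOL-Computational_Algebra.Group_Closure"
begin

text \<open>
  The root lattice of type F4 is \<open>int ^ 4\<close>, written in the basis of simple roots, and a simple
  root is represented by its Bourbaki index.  The type \<open>4\<close> has exactly the elements 1, 2, 3, 4
  (with 4 = 0), so subsets of the set of simple roots are subsets of this type.
\<close>

type_synonym root_lattice = "int ^ 4"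

definition simple_root :: "4 \<Rightarrow> root_lattice"  (\<open>\<alpha>\<close>)
  where "\<alpha> i = axis i 1"

text \<open>The entry in row \<open>i\<close>, column \<open>j\<close> is the value of the \<open>i\<close>-th simple coroot on \<open>\<alpha> j\<close>.\<close>

definition cartan_F4 :: "int ^ 4 ^ 4"
  where "cartan_F4 = vector
    [vector [ 2, -1,  0,  0],
     vector [-1,  2, -1,  0],
     vector [ 0, -2,  2, -1],
     vector [ 0,  0, -1,  2]]"

definition coroot :: "4 \<Rightarrow> root_lattice \<Rightarrow> int"
  where "coroot i x = (cartan_F4 *v x) $ i"

lemma coroot_simple_root:
  "coroot 2 (\<alpha> 3) = -1" "coroot 3 (\<alpha> 2) = -2" "coroot i (\<alpha> i) = 2"
  "coroot 1 (\<alpha> 2) = -1" "coroot 2 (\<alpha> 1) = -1" "coroot 3 (\<alpha> 4) = -1" "coroot 4 (\<alpha> 3) = -1"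
  "coroot 1 (\<alpha> 3) = 0" "coroot 1 (\<alpha> 4) = 0" "coroot 2 (\<alpha> 4) = 0"
  "coroot 3 (\<alpha> 1) = 0" "coroot 4 (\<alpha> 1) = 0" "coroot 4 (\<alpha> 2) = 0"
  using exhaust_4[of i]
  by (auto simp: coroot_def cartan_F4_def simple_root_def matrix_vector_mult_def sum_4 axis_def vector_def)

definition spherical_roots :: "root_lattice set"
  where "spherical_roots =
    range \<alpha> \<union> range (\<lambda>i. 2 *s \<alpha> i) \<union>
    {\<alpha> 1 + \<alpha> 3, \<alpha> 1 + \<alpha> 4, \<alpha> 2 + \<alpha> 4,
     \<alpha> 1 + \<alpha> 2, \<alpha> 3 + \<alpha> 4,
     \<alpha> 2 + \<alpha> 3, 2 *s \<alpha> 2 + 2 *s \<alpha> 3,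
     \<alpha> 1 + \<alpha> 2 + \<alpha> 3, 2 *s \<alpha> 1 + 2 *s \<alpha> 2 + 2 *s \<alpha> 3, \<alpha> 1 + 2 *s \<alpha> 2 + 3 *s \<alpha> 3,
     \<alpha> 2 + 2 *s \<alpha> 3 + \<alpha> 4,
     \<alpha> 1 + 2 *s \<alpha> 2 + 3 *s \<alpha> 3 + 2 *s \<alpha> 4}"

text \<open>A simple root is orthogonal to \<open>\<sigma>\<close> iff its coroot vanishes on \<open>\<sigma>\<close>.\<close>

definition S_p :: "root_lattice \<Rightarrow> 4 set"
  where "S_p \<sigma> = {i. coroot i \<sigma> = 0}"

definition supp :: "root_lattice \<Rightarrow> 4 set"
  where "supp \<sigma> = {i. \<sigma> $ i \<noteq> 0}"

definition S_pp :: "root_lattice \<Rightarrow> 4 set"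
  where "S_pp \<sigma> =
    (if \<sigma> = \<alpha> 2 + \<alpha> 3 \<or> \<sigma> = \<alpha> 1 + \<alpha> 2 + \<alpha> 3 then S_p \<sigma> \<inter> supp \<sigma> - {3}
     else if \<sigma> = \<alpha> 2 + 2 *s \<alpha> 3 + \<alpha> 4 then S_p \<sigma> \<inter> supp \<sigma> - {4}
     else S_p \<sigma> \<inter> supp \<sigma>)"

definition compatible :: "root_lattice \<Rightarrow> 4 set \<Rightarrow> bool"
  where "compatible \<sigma> P \<longleftrightarrow> S_pp \<sigma> \<subseteq> P \<and> P \<subseteq> S_p \<sigma>"

definition proportional :: "root_lattice \<Rightarrow> root_lattice \<Rightarrow> bool"
  where "proportional x y \<longleftrightarrow> (\<exists>m n. m \<noteq> 0 \<and> n \<noteq> 0 \<and> m *s x = n *s y)"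

text \<open>
  The finite set \<open>A\<close> is labelled by natural numbers, which loses nothing up to isomorphism.
  The value of \<open>c d\<close> only matters for \<open>d\<close> in \<open>A\<close> and on the lattice generated by the
  spherical roots of the system.
\<close>

record system_data =
  sys_roots :: "root_lattice set"
  sys_p :: "4 set"
  sys_A :: "nat set"
  sys_c :: "nat \<Rightarrow> root_lattice \<Rightarrow> int"

definition additive_on_closure :: "root_lattice set \<Rightarrow> (root_lattice \<Rightarrow> int) \<Rightarrow> bool"
  where "additive_on_closure \<Gamma> f \<longleftrightarrow>
    (\<forall>x \<in> group_closure \<Gamma>. \<forall>y \<in> group_closure \<Gamma>. f (x + y) = f x + f y)"

definition A_of :: "system_data \<Rightarrow> 4 \<Rightarrow> nat set"
  where "A_of X i = {d \<in> sys_A X. sys_c X d (\<alpha> i) = 1}"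

definition axiom_S :: "system_data \<Rightarrow> bool"
  where "axiom_S X \<longleftrightarrow> (\<forall>\<sigma> \<in> sys_roots X. compatible \<sigma> (sys_p X))"

definition axiom_A1 :: "system_data \<Rightarrow> bool"
  where "axiom_A1 X \<longleftrightarrow> (\<forall>d \<in> sys_A X. \<forall>\<sigma> \<in> sys_roots X.
    sys_c X d \<sigma> \<le> 1 \<and> (sys_c X d \<sigma> = 1 \<longrightarrow> \<sigma> \<in> range \<alpha> \<inter> sys_roots X))"

definition axiom_A2 :: "system_data \<Rightarrow> bool"
  where "axiom_A2 X \<longleftrightarrow> (\<forall>i. \<alpha> i \<in> sys_roots X \<longrightarrow>
    (\<exists>p q. p \<noteq> q \<and> A_of X i = {p, q} \<and>
      (\<forall>\<sigma> \<in> sys_roots X. sys_c X p \<sigma> + sys_c X q \<sigma> = coroot i \<sigma>)))"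

definition axiom_A3 :: "system_data \<Rightarrow> bool"
  where "axiom_A3 X \<longleftrightarrow> sys_A X = (\<Union>i \<in> {i. \<alpha> i \<in> sys_roots X}. A_of X i)"

definition axiom_Sigma1 :: "system_data \<Rightarrow> bool"
  where "axiom_Sigma1 X \<longleftrightarrow> (\<forall>i. 2 *s \<alpha> i \<in> sys_roots X \<longrightarrow>
    (\<forall>\<sigma> \<in> sys_roots X - {2 *s \<alpha> i}. even (coroot i \<sigma>) \<and> coroot i \<sigma> \<le> 0))"

definition axiom_Sigma2 :: "system_data \<Rightarrow> bool"
  where "axiom_Sigma2 X \<longleftrightarrow> (\<forall>i j. coroot i (\<alpha> j) = 0 \<and> \<alpha> i + \<alpha> j \<in> sys_roots X \<longrightarrow>
    (\<forall>\<sigma> \<in> sys_roots X. coroot i \<sigma> = coroot j \<sigma>))"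

definition spherical_system :: "system_data \<Rightarrow> bool"
  where "spherical_system X \<longleftrightarrow>
    sys_roots X \<subseteq> spherical_roots \<and>
    (\<forall>\<sigma> \<in> sys_roots X. \<forall>\<tau> \<in> sys_roots X. \<sigma> \<noteq> \<tau> \<longrightarrow> \<not> proportional \<sigma> \<tau>) \<and>
    finite (sys_A X) \<and>
    (\<forall>d \<in> sys_A X. additive_on_closure (sys_roots X) (sys_c X d)) \<and>
    axiom_S X \<and> axiom_A1 X \<and> axiom_A2 X \<and> axiom_A3 X \<and> axiom_Sigma1 X \<and> axiom_Sigma2 X"

definition sys_rank :: "system_data \<Rightarrow> nat"
  where "sys_rank X = card (sys_roots X)"

definition isomorphic :: "system_data \<Rightarrow> system_data \<Rightarrow> bool"
  where "isomorphic X Y \<longleftrightarrow>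
    sys_roots X = sys_roots Y \<and> sys_p X = sys_p Y \<and>
    (\<exists>f. bij_betw f (sys_A X) (sys_A Y) \<and>
      (\<forall>d \<in> sys_A X. \<forall>x \<in> group_closure (sys_roots X). sys_c Y (f d) x = sys_c X d x))"

definition iso_rel :: "(system_data \<times> system_data) set"
  where "iso_rel = {(X, Y). spherical_system X \<and> spherical_system Y \<and> isomorphic X Y}"

lemma equiv_iso_rel: "equiv {X. spherical_system X} iso_rel"
proof (rule equivI)
  show "iso_rel \<subseteq> {X. spherical_system X} \<times> {X. spherical_system X}"
    by (auto simp: iso_rel_def)
  show "refl_on {X. spherical_system X} iso_rel"
    by (auto simp: refl_on_def iso_rel_def isomorphic_def intro!: exI[of _ id])
  show "sym iso_rel"
  proof (rule symI)
    fix X Y assume XY: "(X, Y) \<in> iso_rel"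
    then obtain f where f: "bij_betw f (sys_A X) (sys_A Y)"
      "\<forall>d \<in> sys_A X. \<forall>x \<in> group_closure (sys_roots X). sys_c Y (f d) x = sys_c X d x"
      by (auto simp: iso_rel_def isomorphic_def)
    let ?g = "inv_into (sys_A X) f"
    have "sys_c X (?g d) x = sys_c Y d x"
      if "d \<in> sys_A Y" "x \<in> group_closure (sys_roots X)" for d x
      using f that
      by (metis bij_betw_def bij_betw_inv_into_right inv_into_into)
    then show "(Y, X) \<in> iso_rel"
      using XY bij_betw_inv_into[OF f(1)]
      by (auto simp: iso_rel_def isomorphic_def intro!: exI[of _ ?g])
  qed
  show "trans iso_rel"
  proof (rule transI)
    fix X Y Z assume XY: "(X, Y) \<in> iso_rel" and YZ: "(Y, Z) \<in> iso_rel"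
    obtain f where f: "bij_betw f (sys_A X) (sys_A Y)"
      "\<forall>d \<in> sys_A X. \<forall>x \<in> group_closure (sys_roots X). sys_c Y (f d) x = sys_c X d x"
      using XY by (auto simp: iso_rel_def isomorphic_def)
    obtain g where g: "bij_betw g (sys_A Y) (sys_A Z)"
      "\<forall>d \<in> sys_A Y. \<forall>x \<in> group_closure (sys_roots Y). sys_c Z (g d) x = sys_c Y d x"
      using YZ by (auto simp: iso_rel_def isomorphic_def)
    have "sys_c Z ((g \<circ> f) d) x = sys_c X d x"
      if "d \<in> sys_A X" "x \<in> group_closure (sys_roots X)" for d x
    proof -
      have "f d \<in> sys_A Y" "x \<in> group_closure (sys_roots Y)"
        using that f(1) XY by (auto simp: iso_rel_def isomorphic_def bij_betw_def)
      then show ?thesis using f(2) g(2) that by simp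
    qed
    then show "(X, Z) \<in> iso_rel"
      using XY YZ bij_betw_trans[OF f(1) g(1)]
      unfolding iso_rel_def isomorphic_def by auto
  qed
qed

definition number_of_systems :: nat
  where "number_of_systems = card ({X. spherical_system X} // iso_rel)"

definition number_of_systems_of_rank :: "nat \<Rightarrow> nat"
  where "number_of_systems_of_rank r =
    card ({X. spherical_system X \<and> sys_rank X = r} // iso_rel)"

end

theory Submission
  imports Defs "HOL-Library.List_Lexorder"
begin

text \<open>
  Up to isomorphism a spherical system is a triple \<open>(\<Sigma>, S\<^sup>p, M)\<close> where \<open>M\<close> is the multiset of value
  vectors on \<open>\<Sigma>\<close> of the elements of \<open>A\<close>.  The conditions on \<open>(\<Sigma>, S\<^sup>p)\<close> are conditions on single
  roots and on pairs of roots, so the possible \<open>\<Sigma>\<close> are the cliques of a graph on 20 vertices.  By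
  (A2) and (A3), \<open>M\<close> is glued from one pair of functionals for every simple root in \<open>\<Sigma>\<close>; by (A1)
  and (A2) there are finitely many candidates for each pair, and the gluing condition is again
  binary.  Both enumerations are carried out by rewriting.  A multiset found in this way comes from
  a system because all the \<open>\<Sigma>\<close> that admit a solution are linearly independent, so that prescribed
  values extend to additive functions.
\<close>

section \<open>Enumeration of lists subject to binary constraints\<close>

text \<open>Restricting the candidates to the neighbours of \<open>x\<close> before the recursive
  call prunes the search and avoids a walk through all sublists.\<close>

fun cliques :: "('a \<Rightarrow> 'a \<Rightarrow> bool) \<Rightarrow> 'a list \<Rightarrow> 'a list list" where
  "cliques R [] = [[]]"
| "cliques R (x # xs) = map ((#) x) (cliques R (filter (R x) xs)) @ cliques R xs"

lemma subseqs_filter: "subseqs (filter P xs) = filter (list_all P) (subseqs xs)"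
  by (induction xs) (auto simp: Let_def filter_map o_def)

text \<open>For a head \<open>x\<close>, \<open>sorted_wrt R (x # ys)\<close> splits into
  \<open>R x\<close> on all of \<open>ys\<close> and \<open>sorted_wrt R ys\<close>. The first
  condition commutes with forming sublists, so it may be imposed on \<open>xs\<close>
  beforehand.\<close>

lemma cliques_eq: "cliques R xs = filter (sorted_wrt R) (subseqs xs)"
proof (induction R xs rule: cliques.induct)
  case (2 R x xs)
  have "(\<lambda>ys. sorted_wrt R (x # ys)) = (\<lambda>ys. sorted_wrt R ys \<and> list_all (R x) ys)"
    by (auto simp: list_all_iff)
  then show ?case
    using 2 by (simp add: Let_def filter_map o_def subseqs_filter conj_commute)
qed simp

lemma filter_in_subseqs: "filter P xs \<in> set (subseqs xs)"
  by (induction xs) (auto simp: Let_def)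

lemma set_subseqs_subset: "ys \<in> set (subseqs xs) \<Longrightarrow> set ys \<subseteq> set xs"
  using subseqs_powset[of xs] by auto

text \<open>Both sides are sublists of \<open>xs\<close> with the same set, and taking sets is
  injective on the sublists of a distinct list. Used to recover a list of roots from its set of
  roots.\<close>

lemma filter_mem_subseq:
  assumes "distinct xs" "ys \<in> set (subseqs xs)"
  shows "filter (\<lambda>x. x \<in> set ys) xs = ys"
proof (rule inj_onD)
  show "inj_on set (set (subseqs xs))"
    using distinct_set_subseqs[OF assms(1)] by (simp add: distinct_map)
  show "set (filter (\<lambda>x. x \<in> set ys) xs) = set ys"
    using set_subseqs_subset[OF assms(2)] by auto
qed (use assms filter_in_subseqs in auto)

text \<open>\<open>sorted_wrt\<close> tests each pair once, in list order; symmetry makes this a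
  test of all pairs.\<close>

lemma sorted_wrt_symp:
  assumes "distinct xs" "\<And>x y. R x y \<Longrightarrow> R y x"
  shows "sorted_wrt R xs \<longleftrightarrow> (\<forall>x \<in> set xs. \<forall>y \<in> set xs. x \<noteq> y \<longrightarrow> R x y)"
  using assms(1) by (induction xs) (auto intro: assms(2))

text \<open>The same pruning as in \<open>cliques\<close>, for products: a choice thins out all
  later factors.\<close>

fun constrained_product :: "('a \<Rightarrow> 'a \<Rightarrow> bool) \<Rightarrow> 'a list list \<Rightarrow> 'a list list" where
  "constrained_product R [] = [[]]"
| "constrained_product R (xs # xss) =
    concat (map (\<lambda>x. map ((#) x) (constrained_product R (map (filter (R x)) xss))) xs)"

lemma product_lists_filter:
  "product_lists (map (filter P) xss) = filter (list_all P) (product_lists xss)"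
proof (induction xss)
  case (Cons xs xss)
  show ?case by (induction xs) (auto simp: Cons filter_map o_def)
qed simp

lemma constrained_product_eq:
  "constrained_product R xss = filter (sorted_wrt R) (product_lists xss)"
proof (induction R xss rule: constrained_product.induct)
  case (2 R xs xss)
  have eq: "(\<lambda>ys. sorted_wrt R (x # ys)) = (\<lambda>ys. sorted_wrt R ys \<and> list_all (R x) ys)" for x
    by (auto simp: list_all_iff)
  have "constrained_product R (xs # xss) = concat (map (\<lambda>x. map ((#) x)
      (filter (sorted_wrt R) (filter (list_all (R x)) (product_lists xss)))) xs)"
    using 2 by (auto simp: product_lists_filter intro!: arg_cong[of _ _ concat])
  also have "\<dots> = filter (sorted_wrt R) (product_lists (xs # xss))"
    by (simp add: filter_concat filter_map o_def eq conj_commute del: sorted_wrt.simps)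
  finally show ?case .
qed simp

section \<open>Multisets glued from overlapping pairs\<close>

lemma image_mset_eq_obtain_bij_betw:
  assumes "finite A" "finite B" "image_mset f (mset_set A) = image_mset g (mset_set B)"
  obtains h where "bij_betw h A B" "\<And>a. a \<in> A \<Longrightarrow> g (h a) = f a"
proof -
  have "\<exists>h. bij_betw h A B \<and> (\<forall>a \<in> A. g (h a) = f a)"
    using assms
  proof (induction A arbitrary: B rule: finite_induct)
    case empty
    then show ?case by (auto simp: mset_set_empty_iff bij_betw_def)
  next
    case (insert a A)
    have "f a \<in># image_mset g (mset_set B)"
      using insert.prems(2)[symmetric] insert.hyps by simp
    then obtain b where b: "b \<in> B" "g b = f a"
      using insert.prems(1) by auto
    then have B: "mset_set B = add_mset b (mset_set (B - {b}))"
      using insert.prems(1) by (simp add: mset_set.remove)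
    have "image_mset f (mset_set A) = image_mset g (mset_set (B - {b}))"
      using insert.prems(2) insert.hyps b(2) B by simp
    then obtain h where h: "bij_betw h A (B - {b})" "\<forall>a \<in> A. g (h a) = f a"
      using insert.IH[of "B - {b}"] insert.prems(1) by auto
    have "bij_betw (h(a := b)) (insert a A) (insert b (B - {b}))"
      using h(1) insert.hyps(2) by (intro bij_betw_combine[of _ A, unfolded Un_insert_right]
        | auto simp: bij_betw_def inj_on_def)+
    then have "bij_betw (h(a := b)) (insert a A) B"
      using b(1) by (simp only: insert_Diff)
    moreover have "\<forall>c \<in> insert a A. g ((h(a := b)) c) = f c"
      using h(2) b(2) insert.hyps(2) by auto
    ultimately show ?case by blast
  qed
  then show ?thesis using that by blast
qed

text \<open>Here \<open>x = y\<close> is allowed: the multiset counts elements of \<open>A\<close>,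
  so \<open>A\<close> has two elements even when their images coincide.\<close>

lemma image_mset_set_eq_pair:
  assumes "finite A" "image_mset f (mset_set A) = {#x, y#}"
  obtains a b where "a \<noteq> b" "A = {a, b}" "f a = x" "f b = y"
proof -
  have "card A = 2"
    using arg_cong[OF assms(2), of size] by simp
  then obtain a b where ab: "A = {a, b}" "a \<noteq> b" by (auto simp: card_2_iff)
  then have "{#f a, f b#} = {#x, y#}" using assms(2) by simp
  then have "f a = x \<and> f b = y \<or> f a = y \<and> f b = x"
    by (auto simp: add_eq_conv_ex)
  then show ?thesis using ab that[of a b] that[of b a] by auto
qed

text \<open>A triple \<open>(k, p, q)\<close> stands for a pair \<open>A(\<alpha>) = {p, q}\<close>, where functionals are given by the
  list of their values on \<open>\<Sigma>\<close> and \<open>\<alpha>\<close> has position \<open>k\<close> in \<open>\<Sigma>\<close>.\<close>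

type_synonym functional_pair = "nat \<times> int list \<times> int list"

text \<open>An element of A lying in several sets A(\<alpha>) must be counted once, so the
  functionals with value 1 at position \<open>k\<close>, which are already \<open>p\<close> and
  \<open>q\<close>, are dropped from the rest.\<close>

fun glue :: "functional_pair list \<Rightarrow> int list multiset" where
  "glue [] = {#}"
| "glue ((k, p, q) # cs) = {#p, q#} + filter_mset (\<lambda>f. f ! k \<noteq> 1) (glue cs)"

text \<open>The overlap of A(\<alpha>) and A(\<beta>), computed from either side, must be the same
  multiset. For lists of at most two elements, equality of multisets is equality up to reversal, so
  the test can be evaluated on lists.\<close>

fun glueable :: "functional_pair \<Rightarrow> functional_pair \<Rightarrow> bool" where
  "glueable (k, p, q) (k', p', q') \<longleftrightarrow>
    (let fs = filter (\<lambda>f. f ! k' = 1) [p, q]; gs = filter (\<lambda>f. f ! k = 1) [p', q']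
     in fs = gs \<or> fs = rev gs)"

lemma mset_filter2_eq_iff:
  "filter_mset P {#a, b#} = filter_mset Q {#c, d#} \<longleftrightarrow>
    filter P [a, b] = filter Q [c, d] \<or> filter P [a, b] = rev (filter Q [c, d])"
  by (auto simp: add_eq_conv_ex)

lemma glueable_iff:
  "glueable (k, p, q) (k', p', q') \<longleftrightarrow>
    filter_mset (\<lambda>f. f ! k' = 1) {#p, q#} = filter_mset (\<lambda>f. f ! k = 1) {#p', q'#}"
  unfolding mset_filter2_eq_iff by (simp add: Let_def)

text \<open>A functional with value 1 at \<open>k\<close> in the glued multiset either comes from
  the head pair and has value 1 at both positions, where \<open>glueable\<close> compares it with
  the pair of \<open>k\<close>, or survives the filter on the tail, where induction applies.\<close>

lemma filter_glue:
  assumes "sorted_wrt glueable cs" "\<And>k p q. (k, p, q) \<in> set cs \<Longrightarrow> p ! k = 1 \<and> q ! k = 1"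
    "(k, p, q) \<in> set cs"
  shows "filter_mset (\<lambda>f. f ! k = 1) (glue cs) = {#p, q#}"
  using assms
proof (induction cs arbitrary: k p q)
  case (Cons c cs)
  obtain l r s where c: "c = (l, r, s)" by (cases c)
  show ?case
  proof (cases "(k, p, q) = c")
    case True
    then show ?thesis using Cons.prems(2)[of k p q] by (simp add: c filter_filter_mset)
  next
    case False
    then have mem: "(k, p, q) \<in> set cs" using Cons.prems(3) by simp
    then have IH: "filter_mset (\<lambda>f. f ! k = 1) (glue cs) = {#p, q#}"
      using Cons.prems by (intro Cons.IH) auto
    have "glueable c (k, p, q)" using Cons.prems(1) mem by simp
    then have "filter_mset (\<lambda>f. f ! k = 1) {#r, s#} = filter_mset (\<lambda>f. f ! l = 1) {#p, q#}"
      unfolding c glueable_iff .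
    moreover have "filter_mset (\<lambda>f. f ! k = 1) (filter_mset (\<lambda>f. f ! l \<noteq> 1) (glue cs)) =
        filter_mset (\<lambda>f. f ! l \<noteq> 1) {#p, q#}"
      unfolding IH[symmetric] by (simp add: filter_filter_mset conj_commute)
    ultimately show ?thesis
      using multiset_partition[of "{#p, q#}" "\<lambda>f. f ! l = 1"]
      by (simp only: c glue.simps filter_union_mset)
  qed
qed simp

text \<open>Conversely, pairs cut out of one multiset glue back to the part of it that they cover:
  the head pair accounts for the functionals with value 1 at \<open>k\<close>, and the filter in
  \<open>glue\<close> leaves exactly the others.\<close>

lemma glue_eq_filter:
  assumes "\<And>k p q. (k, p, q) \<in> set cs \<Longrightarrow> filter_mset (\<lambda>f. f ! k = 1) M = {#p, q#}"
  shows "glue cs = filter_mset (\<lambda>f. \<exists>(k, p, q) \<in> set cs. f ! k = 1) M"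
  using assms
proof (induction cs)
  case (Cons c cs)
  obtain k p q where c: "c = (k, p, q)" by (cases c)
  have "filter_mset (\<lambda>f. \<exists>(k, p, q) \<in> set (c # cs). f ! k = 1) M =
      filter_mset (\<lambda>f. f ! k = 1) M +
      filter_mset (\<lambda>f. f ! k \<noteq> 1) (filter_mset (\<lambda>f. \<exists>(k, p, q) \<in> set cs. f ! k = 1) M)"
    by (rule multiset_eqI) (auto simp: c)
  moreover have "glue cs = filter_mset (\<lambda>f. \<exists>(k, p, q) \<in> set cs. f ! k = 1) M"
    using Cons.prems by (intro Cons.IH) auto
  moreover have "filter_mset (\<lambda>f. f ! k = 1) M = {#p, q#}"
    using Cons.prems[of k p q] by (simp add: c)
  ultimately show ?case by (simp only: c glue.simps)
qed simp

section \<open>Solutions of the axioms on \<open>A\<close> for a given set of spherical roots\<close>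

type_synonym coords = "int \<times> int \<times> int \<times> int"

fun coord_list :: "coords \<Rightarrow> int list" where
  "coord_list (a, b, c, d) = [a, b, c, d]"

text \<open>The Cartan matrix of type F4 applied to the coordinate vector; entry \<open>i\<close>
  belongs to the \<open>i\<close>-th simple coroot, counted from 0.\<close>

fun coroot_list :: "coords \<Rightarrow> int list" where
  "coroot_list (a, b, c, d) = [2 * a - b, 2 * b - a - c, 2 * c - 2 * b - d, 2 * d - c]"

definition simple_list :: "coords list" where
  "simple_list = [(1, 0, 0, 0), (0, 1, 0, 0), (0, 0, 1, 0), (0, 0, 0, 1)]"

text \<open>Values are integers, so (A1) amounts to the bound 1 on simple roots and the bound 0 on
  all other roots.\<close>

definition upper :: "coords \<Rightarrow> int" where
  "upper t = (if t \<in> set simple_list then 1 else 0)"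

definition simple_positions :: "coords list \<Rightarrow> (nat \<times> nat) list" where
  "simple_positions ss =
    concat (map (\<lambda>k. map (Pair k) (filter (\<lambda>i. ss ! k = simple_list ! i) [0..<4])) [0..<length ss])"

text \<open>The order on lists is lexicographic; \<open>q \<le> p\<close> picks one representative of each unordered pair.\<close>

definition pair_candidates :: "coords list \<Rightarrow> nat \<times> nat \<Rightarrow> functional_pair list" where
  "pair_candidates ss = (\<lambda>(k, i).
    map (\<lambda>p. (k, p, map2 (\<lambda>x t. coroot_list t ! i - x) p ss))
      (filter (\<lambda>p. map2 (\<lambda>x t. coroot_list t ! i - x) p ss \<le> p)
        (product_lists (map (\<lambda>t. [coroot_list t ! i - upper t..upper t]) ss))))"

definition solutions :: "coords list \<Rightarrow> functional_pair list list" where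
  "solutions ss = constrained_product glueable (map (pair_candidates ss) (simple_positions ss))"

text \<open>Axioms (A1)--(A3) for functionals given by their values: the bound \<^const>\<open>upper\<close> is (A1),
  and the existence of a simple root with value 1 is (A3).\<close>

definition valid_functionals :: "coords list \<Rightarrow> int list multiset \<Rightarrow> bool" where
  "valid_functionals ss M \<longleftrightarrow>
    (\<forall>f \<in># M. length f = length ss \<and> (\<forall>j < length ss. f ! j \<le> upper (ss ! j)) \<and>
      (\<exists>(k, i) \<in> set (simple_positions ss). f ! k = 1)) \<and>
    (\<forall>(k, i) \<in> set (simple_positions ss). \<exists>p q. filter_mset (\<lambda>f. f ! k = 1) M = {#p, q#} \<and>
      (\<forall>j < length ss. p ! j + q ! j = coroot_list (ss ! j) ! i))"

section \<open>Characterization of the candidate pairs and of the solution lists\<close>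

lemma set_simple_positions:
  "(k, i) \<in> set (simple_positions ss) \<longleftrightarrow> k < length ss \<and> i < 4 \<and> ss ! k = simple_list ! i"
  by (auto simp: simple_positions_def)

lemma less_4_cases: "(i :: nat) < 4 \<longleftrightarrow> i = 0 \<or> i = 1 \<or> i = 2 \<or> i = 3"
  by auto

lemma coroot_list_simple: "i < 4 \<Longrightarrow> coroot_list (simple_list ! i) ! i = 2"
  by (auto simp: less_4_cases simple_list_def)

lemma upper_simple: "i < 4 \<Longrightarrow> upper (simple_list ! i) = 1"
  by (auto simp: less_4_cases simple_list_def upper_def)

text \<open>The lower bound on \<open>p\<close> in the enumeration is the upper bound on its partner
  \<open>q\<close>, which is the coroot value minus \<open>p\<close>. Hence both members satisfy
  (A1), and only finitely many \<open>p\<close> remain.\<close>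

lemma pair_candidates_iff:
  "(l, p, q) \<in> set (pair_candidates ss (k, i)) \<longleftrightarrow>
    l = k \<and> length p = length ss \<and> length q = length ss \<and> q \<le> p \<and>
    (\<forall>j < length ss. p ! j \<le> upper (ss ! j) \<and> q ! j \<le> upper (ss ! j) \<and>
      p ! j + q ! j = coroot_list (ss ! j) ! i)" (is "?L \<longleftrightarrow> ?R")
proof -
  let ?q = "map2 (\<lambda>x t. coroot_list t ! i - x) p ss"
  have mem: "p \<in> set (product_lists (map (\<lambda>t. [coroot_list t ! i - upper t..upper t]) ss)) \<longleftrightarrow>
      length p = length ss \<and>
      (\<forall>j < length ss. coroot_list (ss ! j) ! i - upper (ss ! j) \<le> p ! j \<and> p ! j \<le> upper (ss ! j))"
    by (auto simp: product_lists_set list_all2_conv_all_nth)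
  have q: "q = ?q \<longleftrightarrow> length q = length ss \<and>
      (\<forall>j < length ss. p ! j + q ! j = coroot_list (ss ! j) ! i)" if "length p = length ss"
    using that by (auto simp: list_eq_iff_nth_eq algebra_simps)
  have "?L \<longleftrightarrow> l = k \<and> q = ?q \<and> q \<le> p \<and> length p = length ss \<and>
      (\<forall>j < length ss. coroot_list (ss ! j) ! i - upper (ss ! j) \<le> p ! j \<and> p ! j \<le> upper (ss ! j))"
    unfolding pair_candidates_def mem[symmetric] by auto
  also have "\<dots> \<longleftrightarrow> ?R"
    using q by (cases "length p = length ss") (simp, smt (verit), simp)
  finally show ?thesis .
qed

text \<open>Both values are at most 1 by (A1) and add up to 2, the value of a simple coroot on its
  own root.\<close>

lemma pair_candidates_at_position:
  assumes "(k, i) \<in> set (simple_positions ss)" "(l, p, q) \<in> set (pair_candidates ss (k, i))"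
  shows "p ! k = 1" "q ! k = 1"
proof -
  have k: "k < length ss" "coroot_list (ss ! k) ! i = 2" "upper (ss ! k) = 1"
    using assms(1) by (auto simp: set_simple_positions coroot_list_simple upper_simple)
  then have "p ! k \<le> 1" "q ! k \<le> 1" "p ! k + q ! k = 2"
    using assms(2) by (auto simp: pair_candidates_iff)
  then show "p ! k = 1" "q ! k = 1" by linarith+
qed

lemma solutions_iff:
  "cs \<in> set (solutions ss) \<longleftrightarrow> sorted_wrt glueable cs \<and>
    list_all2 (\<lambda>c ki. c \<in> set (pair_candidates ss ki)) cs (simple_positions ss)"
  by (auto simp: solutions_def constrained_product_eq product_lists_set list_all2_map2)

text \<open>A candidate is determined by its \<open>p\<close>, so no pair is listed twice; this lets
  \<open>length\<close> count solutions.\<close>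

lemma distinct_solutions: "distinct (solutions ss)"
proof -
  have "distinct (pair_candidates ss (k, i))" for k i
    by (auto simp: pair_candidates_def distinct_map inj_on_def intro!: distinct_filter distinct_product_lists)
  then show ?thesis
    unfolding solutions_def constrained_product_eq
    by (intro distinct_filter distinct_product_lists) auto
qed

lemma solution_memberE:
  assumes "cs \<in> set (solutions ss)" "(k, p, q) \<in> set cs"
  obtains i where "(k, i) \<in> set (simple_positions ss)" "(k, p, q) \<in> set (pair_candidates ss (k, i))"
proof -
  obtain n where n: "n < length cs" "cs ! n = (k, p, q)"
    using assms(2) by (auto simp: in_set_conv_nth)
  obtain l i where li: "simple_positions ss ! n = (l, i)" by fastforce
  have "n < length (simple_positions ss)" "(k, p, q) \<in> set (pair_candidates ss (l, i))"
    using assms(1) n li by (auto simp: solutions_iff list_all2_conv_all_nth)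
  then have "(l, i) \<in> set (simple_positions ss)" "(k, p, q) \<in> set (pair_candidates ss (l, i))"
    using li nth_mem by metis+
  moreover from this have "l = k" by (simp add: pair_candidates_iff)
  ultimately show ?thesis using that by simp
qed

lemma solution_positionE:
  assumes "cs \<in> set (solutions ss)" "(k, i) \<in> set (simple_positions ss)"
  obtains p q where "(k, p, q) \<in> set cs" "(k, p, q) \<in> set (pair_candidates ss (k, i))"
proof -
  obtain n where n: "n < length (simple_positions ss)" "simple_positions ss ! n = (k, i)"
    using assms(2) by (auto simp: in_set_conv_nth)
  obtain l p q where c: "cs ! n = (l, p, q)" by (cases "cs ! n")
  have "n < length cs" "(l, p, q) \<in> set (pair_candidates ss (k, i))"
    using assms(1) n c by (auto simp: solutions_iff list_all2_conv_all_nth)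
  moreover from this have "(l, p, q) \<in> set cs" using c nth_mem by metis
  moreover have "l = k" using calculation by (simp add: pair_candidates_iff)
  ultimately show ?thesis using that by simp
qed

section \<open>Bijection between solutions and valid multisets of functionals\<close>

lemma solutions_glue:
  assumes cs: "cs \<in> set (solutions ss)" and mem: "(k, p, q) \<in> set cs"
  shows "filter_mset (\<lambda>f. f ! k = 1) (glue cs) = {#p, q#}"
proof (rule filter_glue)
  show "p ! k = 1 \<and> q ! k = 1" if "(k, p, q) \<in> set cs" for k p q
    using solution_memberE[OF cs that] pair_candidates_at_position by metis
qed (use assms in \<open>auto simp: solutions_iff\<close>)

lemma set_glue: "f \<in># glue cs \<Longrightarrow> \<exists>k p q. (k, p, q) \<in> set cs \<and> (f = p \<or> f = q)"
  by (induction cs rule: glue.induct) auto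

text \<open>(A1) holds because every functional belongs to a candidate pair, and (A3) because it has
  value 1 at the position of that pair. (A2) holds because each pair can be read off from the glued
  multiset, by \<open>solutions_glue\<close>.\<close>

lemma solutions_sound:
  assumes cs: "cs \<in> set (solutions ss)"
  shows "valid_functionals ss (glue cs)"
  unfolding valid_functionals_def
proof (intro conjI ballI)
  fix f assume "f \<in># glue cs"
  then obtain k p q where kpq: "(k, p, q) \<in> set cs" "f = p \<or> f = q"
    using set_glue by metis
  obtain i where i: "(k, i) \<in> set (simple_positions ss)" "(k, p, q) \<in> set (pair_candidates ss (k, i))"
    using solution_memberE[OF cs kpq(1)] .
  show "length f = length ss" "\<forall>j < length ss. f ! j \<le> upper (ss ! j)"
    using i(2) kpq(2) by (auto simp: pair_candidates_iff)
  show "\<exists>(k, i) \<in> set (simple_positions ss). f ! k = 1"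
    using i kpq(2) pair_candidates_at_position[OF i] by auto
next
  fix ki assume ki: "ki \<in> set (simple_positions ss)"
  obtain k i where [simp]: "ki = (k, i)" by (cases ki)
  obtain p q where c: "(k, p, q) \<in> set cs" "(k, p, q) \<in> set (pair_candidates ss (k, i))"
    using solution_positionE[OF cs, of k i] ki by auto
  show "case ki of (k, i) \<Rightarrow> \<exists>p q. filter_mset (\<lambda>f. f ! k = 1) (glue cs) = {#p, q#} \<and>
      (\<forall>j < length ss. p ! j + q ! j = coroot_list (ss ! j) ! i)"
    unfolding \<open>ki = (k, i)\<close> prod.case using solutions_glue[OF cs c(1)] c(2)
    by (intro exI[of _ p] exI[of _ q]) (simp add: pair_candidates_iff)
qed

text \<open>At each simple position the functionals with value 1 are cut out of \<open>M\<close>;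
  they form a pair by (A2). Glueing these pairs gives all of \<open>M\<close> because of
  (A3).\<close>

lemma solutions_complete:
  assumes M: "valid_functionals ss M"
  shows "\<exists>cs \<in> set (solutions ss). glue cs = M"
proof -
  have "\<exists>c \<in> set (pair_candidates ss ki).
      filter_mset (\<lambda>f. f ! fst ki = 1) M = {#fst (snd c), snd (snd c)#}"
    if pos: "ki \<in> set (simple_positions ss)" for ki
  proof -
    obtain k i where ki: "ki = (k, i)" by (cases ki)
    obtain p q where pq: "filter_mset (\<lambda>f. f ! k = 1) M = {#p, q#}"
      "\<forall>j < length ss. p ! j + q ! j = coroot_list (ss ! j) ! i"
      using M[unfolded valid_functionals_def, THEN conjunct2, rule_format, OF pos] ki by auto
    have "p \<in># filter_mset (\<lambda>f. f ! k = 1) M" "q \<in># filter_mset (\<lambda>f. f ! k = 1) M"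
      unfolding pq(1) by auto
    then have "p \<in># M" "q \<in># M" by auto
    then have bounds: "length p = length ss" "length q = length ss"
      "\<forall>j < length ss. p ! j \<le> upper (ss ! j)" "\<forall>j < length ss. q ! j \<le> upper (ss ! j)"
      using M unfolding valid_functionals_def by auto
    show ?thesis
    \<comment> \<open>Only the orientation with the larger functional first is listed as a
      candidate.\<close>
    proof (cases "q \<le> p")
      case True
      then show ?thesis using bounds pq ki
        by (intro bexI[of _ "(k, p, q)"]) (auto simp: pair_candidates_iff)
    next
      case False
      then show ?thesis using bounds pq ki
        by (intro bexI[of _ "(k, q, p)"])
          (auto simp: pair_candidates_iff add.commute add_mset_commute)
    qed
  qed
  then obtain c where c: "\<And>ki. ki \<in> set (simple_positions ss) \<Longrightarrow> c ki \<in> set (pair_candidates ss ki)"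
    "\<And>ki. ki \<in> set (simple_positions ss) \<Longrightarrow>
      filter_mset (\<lambda>f. f ! fst ki = 1) M = {#fst (snd (c ki)), snd (snd (c ki))#}"
    by metis
  have fst_c: "fst (c ki) = fst ki" if "ki \<in> set (simple_positions ss)" for ki
    using c(1)[OF that] by (metis pair_candidates_iff surjective_pairing)
  let ?cs = "map c (simple_positions ss)"
  have glueable: "glueable (c ki) (c kj)"
    if "ki \<in> set (simple_positions ss)" "kj \<in> set (simple_positions ss)" for ki kj
  proof -
    obtain k p q where k: "c ki = (k, p, q)" by (cases "c ki")
    obtain l r s where l: "c kj = (l, r, s)" by (cases "c kj")
    have "filter_mset (\<lambda>f. f ! k = 1) M = {#p, q#}" "filter_mset (\<lambda>f. f ! l = 1) M = {#r, s#}"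
      using c(2)[OF that(1)] fst_c[OF that(1)] c(2)[OF that(2)] fst_c[OF that(2)] k l by auto
    \<comment> \<open>This common part of \<open>M\<close> is the overlap compared by
      \<open>glueable\<close>.\<close>
    moreover have "filter_mset (\<lambda>f. f ! l = 1) (filter_mset (\<lambda>f. f ! k = 1) M) =
        filter_mset (\<lambda>f. f ! k = 1) (filter_mset (\<lambda>f. f ! l = 1) M)"
      by (simp add: filter_filter_mset conj_commute)
    ultimately show ?thesis unfolding k l glueable_iff by (simp only:)
  qed
  have "?cs \<in> set (solutions ss)"
    using c(1) glueable
    by (auto simp: solutions_iff list_all2_conv_all_nth sorted_wrt_iff_nth_less)
  moreover have "glue ?cs = filter_mset (\<lambda>f. \<exists>(k, p, q) \<in> set ?cs. f ! k = 1) M"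
  proof (rule glue_eq_filter)
    fix k p q assume "(k, p, q) \<in> set ?cs"
    then obtain ki where "ki \<in> set (simple_positions ss)" "c ki = (k, p, q)" by auto
    then show "filter_mset (\<lambda>f. f ! k = 1) M = {#p, q#}"
      using c(2)[of ki] fst_c[of ki] by simp
  qed
  moreover have "\<exists>(k, p, q) \<in> set ?cs. f ! k = 1" if "f \<in># M" for f
  proof -
    obtain k i where "(k, i) \<in> set (simple_positions ss)" "f ! k = 1"
      using M \<open>f \<in># M\<close> unfolding valid_functionals_def by auto
    then show ?thesis using fst_c[of "(k, i)"] by (intro bexI[of _ "c (k, i)"]) (auto split: prod.splits)
  qed
  ultimately show ?thesis by (metis (no_types, lifting) filter_mset_True filter_mset_cong)
qed

text \<open>By \<open>solutions_glue\<close> the pair at each position is recovered from the glued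
  multiset up to order, and \<open>q \<le> p\<close> fixes the order.\<close>

lemma inj_on_glue: "inj_on glue (set (solutions ss))"
proof (rule inj_onI)
  fix cs ds assume cs: "cs \<in> set (solutions ss)" and ds: "ds \<in> set (solutions ss)"
    and eq: "glue cs = glue ds"
  have all2: "list_all2 (\<lambda>c ki. c \<in> set (pair_candidates ss ki)) cs (simple_positions ss)"
    "list_all2 (\<lambda>c ki. c \<in> set (pair_candidates ss ki)) ds (simple_positions ss)"
    using cs ds by (auto simp: solutions_iff)
  then have len: "length cs = length ds" by (simp add: list_all2_conv_all_nth)
  show "cs = ds"
  proof (rule nth_equalityI[OF len])
    fix n assume n: "n < length cs"
    obtain k p q where c: "cs ! n = (k, p, q)" by (cases "cs ! n")
    obtain l r s where d: "ds ! n = (l, r, s)" by (cases "ds ! n")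
    obtain m i where ki: "simple_positions ss ! n = (m, i)" by (cases "simple_positions ss ! n")
    have mem: "(k, p, q) \<in> set (pair_candidates ss (m, i))" "(l, r, s) \<in> set (pair_candidates ss (m, i))"
      using all2 n len unfolding list_all2_conv_all_nth c[symmetric] d[symmetric] ki[symmetric] by auto
    then have "k = l" "q \<le> p" "s \<le> r" by (auto simp: pair_candidates_iff)
    moreover have "{#p, q#} = {#r, s#}"
      using solutions_glue[OF cs, of k p q] solutions_glue[OF ds, of l r s] n len c d eq \<open>k = l\<close>
      by (metis nth_mem)
    then have "p = r \<and> q = s \<or> p = s \<and> q = r" by (auto simp: add_eq_conv_ex)
    ultimately show "cs ! n = ds ! n" unfolding c d by auto
  qed
qed

lemma valid_functionals_eq: "{M. valid_functionals ss M} = glue ` set (solutions ss)"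
  using solutions_sound solutions_complete by blast

lemma card_valid_functionals: "card {M. valid_functionals ss M} = length (solutions ss)"
  by (simp add: valid_functionals_eq card_image inj_on_glue distinct_card distinct_solutions)

section \<open>Coordinates of the spherical roots\<close>

definition vec_of :: "coords \<Rightarrow> root_lattice" where
  "vec_of t = vector (coord_list t)"

text \<open>Coordinate \<open>i\<close> of a list, counted from 0, belongs to the Bourbaki index \<open>i + 1\<close>.\<close>

definition bourbaki :: "nat \<Rightarrow> 4" where
  "bourbaki i = [1, 2, 3, 4] ! i"

definition double_list :: "coords list" where
  "double_list = [(2, 0, 0, 0), (0, 2, 0, 0), (0, 0, 2, 0), (0, 0, 0, 2)]"

definition root_list :: "coords list" where
  "root_list = simple_list @ double_list @
    [(1, 0, 1, 0), (1, 0, 0, 1), (0, 1, 0, 1), (1, 1, 0, 0), (0, 0, 1, 1), (0, 1, 1, 0),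
     (0, 2, 2, 0), (1, 1, 1, 0), (2, 2, 2, 0), (1, 2, 3, 0), (0, 1, 2, 1), (1, 2, 3, 2)]"

text \<open>Numbers below 4 can index lists; this rule translates quantifiers over the type
  \<open>4\<close>.\<close>

lemma all_bourbaki: "(\<forall>i. P i) \<longleftrightarrow> (\<forall>i < 4. P (bourbaki i))"
  by (auto simp: forall_4 less_4_cases bourbaki_def)

lemma ex_bourbaki: "(\<exists>i. P i) \<longleftrightarrow> (\<exists>i < 4. P (bourbaki i))"
  using all_bourbaki[of "\<lambda>i. \<not> P i"] by blast

lemma bourbaki_inject: "i < 4 \<Longrightarrow> j < 4 \<Longrightarrow> bourbaki i = bourbaki j \<longleftrightarrow> i = j"
  by (auto simp: less_4_cases bourbaki_def)

lemma vec_of_nth: "i < 4 \<Longrightarrow> vec_of t $ bourbaki i = coord_list t ! i"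
  by (cases t) (auto simp: less_4_cases bourbaki_def vec_of_def vector_def)

lemma vec_of_eq_iff: "x = vec_of t \<longleftrightarrow> (\<forall>i < 4. x $ bourbaki i = coord_list t ! i)"
  by (simp add: vec_eq_iff all_bourbaki vec_of_nth)

lemma vec_of_inject [simp]: "vec_of s = vec_of t \<longleftrightarrow> s = t"
  by (cases s; cases t) (auto simp: vec_of_eq_iff vec_of_nth less_4_cases all_conj_distrib imp_conjL)

lemma inj_vec_of: "inj vec_of"
  by (simp add: inj_def)

lemma coroot_vec_of: "i < 4 \<Longrightarrow> coroot (bourbaki i) (vec_of t) = coroot_list t ! i"
  by (cases t) (auto simp: less_4_cases bourbaki_def coroot_def cartan_F4_def
      matrix_vector_mult_def sum_4 vec_of_def vector_def)

lemma simple_root_nth: "\<alpha> i $ j = (if i = j then 1 else 0)"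
  by (simp add: simple_root_def axis_def)

lemma simple_root_bourbaki: "i < 4 \<Longrightarrow> \<alpha> (bourbaki i) = vec_of (simple_list ! i)"
  by (auto simp: vec_of_eq_iff simple_root_nth bourbaki_inject)
    (auto simp: less_4_cases simple_list_def)

lemma double_root_bourbaki: "i < 4 \<Longrightarrow> 2 *s \<alpha> (bourbaki i) = vec_of (double_list ! i)"
  by (auto simp: vec_of_eq_iff simple_root_nth bourbaki_inject)
    (auto simp: less_4_cases double_list_def)

lemma simple_root_vec_of:
  "\<alpha> 1 = vec_of (1, 0, 0, 0)" "\<alpha> 2 = vec_of (0, 1, 0, 0)"
  "\<alpha> 3 = vec_of (0, 0, 1, 0)" "\<alpha> 4 = vec_of (0, 0, 0, 1)"
  using simple_root_bourbaki[of 0] simple_root_bourbaki[of 1]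
    simple_root_bourbaki[of 2] simple_root_bourbaki[of 3]
  by (auto simp: bourbaki_def simple_list_def)

lemma vec_of_add: "vec_of (a, b, c, d) + vec_of (a', b', c', d') = vec_of (a + a', b + b', c + c', d + d')"
  by (auto simp: vec_of_eq_iff vec_of_nth less_4_cases)

lemma vec_of_scale: "n *s vec_of (a, b, c, d) = vec_of (n * a, n * b, n * c, n * d)"
  by (auto simp: vec_of_eq_iff vec_of_nth less_4_cases)

lemma range_bourbaki: "range f = (\<lambda>i. f (bourbaki i)) ` {..<4}"
proof -
  have "i \<in> bourbaki ` {..<4}" for i
    using ex_bourbaki[of "\<lambda>j. i = j"] by auto
  then have "bourbaki ` {..<4} = UNIV" by auto
  moreover have "(\<lambda>i. f (bourbaki i)) ` {..<4} = f ` (bourbaki ` {..<4})"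
    by (simp only: image_image)
  ultimately show ?thesis by (simp only:)
qed

lemma spherical_roots_eq: "spherical_roots = vec_of ` set root_list"
proof -
  have four: "{..<4} = {0, 1, 2, 3 :: nat}" by auto
  have "range \<alpha> = (\<lambda>i. vec_of (simple_list ! i)) ` {..<4}"
    unfolding range_bourbaki[of \<alpha>] by (intro image_cong) (auto simp: simple_root_bourbaki)
  moreover have "range (\<lambda>i. 2 *s \<alpha> i) = (\<lambda>i. vec_of (double_list ! i)) ` {..<4}"
    unfolding range_bourbaki[of "\<lambda>i. 2 *s \<alpha> i"]
    by (intro image_cong) (auto simp: double_root_bourbaki)
  ultimately have "range \<alpha> = vec_of ` set simple_list" "range (\<lambda>i. 2 *s \<alpha> i) = vec_of ` set double_list"
    unfolding four by (simp_all add: simple_list_def double_list_def)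
  then show ?thesis
    unfolding spherical_roots_def root_list_def
    by (simp add: simple_root_vec_of vec_of_add vec_of_scale image_Un Un_assoc)
qed

lemma distinct_root_list: "distinct root_list"
  by (simp add: root_list_def simple_list_def double_list_def)

lemma zero_notin_root_list: "(0, 0, 0, 0) \<notin> set root_list"
  by (simp add: root_list_def simple_list_def double_list_def)

lemma vec_of_in_range_simple: "vec_of t \<in> range \<alpha> \<longleftrightarrow> t \<in> set simple_list"
proof -
  have "length simple_list = 4" by (simp add: simple_list_def)
  moreover have "vec_of t \<in> range \<alpha> \<longleftrightarrow> (\<exists>i < 4. vec_of t = vec_of (simple_list ! i))"
    unfolding image_iff bex_UNIV ex_bourbaki by (auto simp: simple_root_bourbaki)
  ultimately show ?thesis by (auto simp: in_set_conv_nth)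
qed

section \<open>The axioms on (\<Sigma>, S^p) as executable tests in coordinates\<close>

definition subset_of :: "bool list \<Rightarrow> 4 set" where
  "subset_of ps = {i. \<exists>k < 4. i = bourbaki k \<and> ps ! k}"

text \<open>The first branch expresses that S^p lies in S^p(\<sigma>), the second that a simple root
  outside S^p is not in S^pp(\<sigma>). Indices 2 and 3 stand for the simple roots removed in the
  exceptional cases of S^pp. Quantifiers range over lists so that they can be evaluated.\<close>

definition compatible_coords :: "bool list \<Rightarrow> coords \<Rightarrow> bool" where
  "compatible_coords ps t \<longleftrightarrow> (\<forall>k \<in> set [0..<4].
    if ps ! k then coroot_list t ! k = 0
    else coroot_list t ! k \<noteq> 0 \<or> coord_list t ! k = 0 \<or>
      k = 2 \<and> (t = (0, 1, 1, 0) \<or> t = (1, 1, 1, 0)) \<or> k = 3 \<and> t = (0, 1, 2, 1))"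

lemma bourbaki_in_subset_of: "k < 4 \<Longrightarrow> bourbaki k \<in> subset_of ps \<longleftrightarrow> ps ! k"
  by (auto simp: subset_of_def bourbaki_inject)

lemma compatible_vec_of: "compatible (vec_of t) (subset_of ps) \<longleftrightarrow> compatible_coords ps t"
proof -
  have special: "vec_of t = \<alpha> 2 + \<alpha> 3 \<longleftrightarrow> t = (0, 1, 1, 0)"
    "vec_of t = \<alpha> 1 + \<alpha> 2 + \<alpha> 3 \<longleftrightarrow> t = (1, 1, 1, 0)"
    "vec_of t = \<alpha> 2 + 2 *s \<alpha> 3 + \<alpha> 4 \<longleftrightarrow> t = (0, 1, 2, 1)"
    by (simp_all add: simple_root_vec_of vec_of_add vec_of_scale)
  have idx: "bourbaki k = 3 \<longleftrightarrow> k = 2" "bourbaki k = 4 \<longleftrightarrow> k = 3" if "k < 4" for k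
    using that by (auto simp: less_4_cases bourbaki_def)
  have pp: "bourbaki k \<in> S_pp (vec_of t) \<longleftrightarrow> coroot_list t ! k = 0 \<and> coord_list t ! k \<noteq> 0 \<and>
      \<not> (k = 2 \<and> (t = (0, 1, 1, 0) \<or> t = (1, 1, 1, 0)) \<or> k = 3 \<and> t = (0, 1, 2, 1))" if "k < 4" for k
    using that by (auto simp: S_pp_def special S_p_def supp_def coroot_vec_of vec_of_nth idx)
  have p: "bourbaki k \<in> S_p (vec_of t) \<longleftrightarrow> coroot_list t ! k = 0" if "k < 4" for k
    using that by (auto simp: S_p_def coroot_vec_of)
  show ?thesis
    unfolding compatible_def subset_iff all_bourbaki compatible_coords_def
    by (auto simp: pp p bourbaki_in_subset_of)
qed

text \<open>Vanishing of the 2 by 2 minors, which replaces the search for multipliers; pairs with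
  \<open>j < i\<close> suffice by antisymmetry.\<close>

definition proportional_coords :: "coords \<Rightarrow> coords \<Rightarrow> bool" where
  "proportional_coords s t \<longleftrightarrow> (\<forall>i \<in> set [0..<4]. \<forall>j \<in> set [0..<i].
    coord_list s ! i * coord_list t ! j = coord_list s ! j * coord_list t ! i)"

text \<open>Cancelling \<open>m\<close> yields the minors from proportionality. Conversely, where
  \<open>x $ i\<close> is nonzero so is \<open>y $ i\<close>, and these two numbers serve as
  multipliers.\<close>

lemma proportional_minors:
  assumes "x \<noteq> 0" "y \<noteq> 0"
  shows "proportional x y \<longleftrightarrow> (\<forall>i j. x $ i * y $ j = x $ j * y $ i)"
proof
  assume "proportional x y"
  then obtain m n where mn: "m \<noteq> 0" "n \<noteq> 0" "m *s x = n *s y" by (auto simp: proportional_def)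
  have eq: "m * x $ k = n * y $ k" for k
    using arg_cong[OF mn(3), of "\<lambda>v. v $ k"] by simp
  have "m * (x $ i * y $ j) = m * (x $ j * y $ i)" for i j
  proof -
    have "m * (x $ i * y $ j) = (m * x $ i) * y $ j" by (simp only: mult.assoc)
    also have "\<dots> = (n * y $ j) * y $ i" by (simp only: eq mult_ac)
    also have "\<dots> = m * (x $ j * y $ i)" by (simp only: eq[symmetric] mult.assoc)
    finally show ?thesis .
  qed
  then show "\<forall>i j. x $ i * y $ j = x $ j * y $ i" using mn(1) by (metis mult_left_cancel)
next
  assume minors: "\<forall>i j. x $ i * y $ j = x $ j * y $ i"
  obtain i where i: "x $ i \<noteq> 0" using assms(1) by (auto simp: vec_eq_iff)
  have "y $ i \<noteq> 0"
  proof
    assume "y $ i = 0"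
    then have "x $ i * y $ j = 0" for j using minors by (metis mult_zero_right)
    then show False using i assms(2) by (auto simp: vec_eq_iff)
  qed
  moreover have "(y $ i) *s x = (x $ i) *s y"
    unfolding vec_eq_iff vector_smult_component using minors by (metis mult.commute)
  ultimately show "proportional x y" using i unfolding proportional_def by blast
qed

lemma proportional_vec_of:
  assumes "s \<noteq> (0, 0, 0, 0)" "t \<noteq> (0, 0, 0, 0)"
  shows "proportional (vec_of s) (vec_of t) \<longleftrightarrow> proportional_coords s t"
proof -
  have zero: "(0 :: root_lattice) = vec_of (0, 0, 0, 0)"
    by (auto simp: vec_of_eq_iff less_4_cases)
  have "proportional (vec_of s) (vec_of t) \<longleftrightarrow> (\<forall>i < 4. \<forall>j < 4.
      coord_list s ! i * coord_list t ! j = coord_list s ! j * coord_list t ! i)"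
  proof -
    have "vec_of s \<noteq> 0" "vec_of t \<noteq> 0" using assms by (simp_all add: zero)
    from proportional_minors[OF this] show ?thesis by (simp add: all_bourbaki vec_of_nth)
  qed
  also have "\<dots> \<longleftrightarrow> proportional_coords s t"
  proof
    assume "proportional_coords s t"
    then have minors: "coord_list s ! i * coord_list t ! j = coord_list s ! j * coord_list t ! i"
      if "i < 4" "j < i" for i j
      using that unfolding proportional_coords_def set_upt by (meson atLeastLessThan_iff le0)
    have "coord_list s ! i * coord_list t ! j = coord_list s ! j * coord_list t ! i"
      if "i < 4" "j < 4" for i j
    proof (cases i j rule: linorder_cases)
      case less
      then show ?thesis by (rule minors[OF that(2), symmetric])
    next
      case greater
      then show ?thesis by (rule minors[OF that(1)])
    qed simp
    then show "\<forall>i < 4. \<forall>j < 4.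
        coord_list s ! i * coord_list t ! j = coord_list s ! j * coord_list t ! i" by blast
  next
    assume "\<forall>i < 4. \<forall>j < 4.
      coord_list s ! i * coord_list t ! j = coord_list s ! j * coord_list t ! i"
    then show "proportional_coords s t"
      unfolding proportional_coords_def set_upt by (meson atLeastLessThan_iff less_trans)
  qed
  finally show ?thesis .
qed

definition sigma1_coords :: "coords \<Rightarrow> coords \<Rightarrow> bool" where
  "sigma1_coords s t \<longleftrightarrow> (\<forall>k \<in> set [0..<4]. s = double_list ! k \<longrightarrow>
    even (coroot_list t ! k) \<and> coroot_list t ! k \<le> 0)"

text \<open>The three roots are the sums of two orthogonal simple roots.\<close>

definition sigma2_coords :: "coords \<Rightarrow> coords \<Rightarrow> bool" where
  "sigma2_coords s t \<longleftrightarrow>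
    (s = (1, 0, 1, 0) \<longrightarrow> coroot_list t ! 0 = coroot_list t ! 2) \<and>
    (s = (1, 0, 0, 1) \<longrightarrow> coroot_list t ! 0 = coroot_list t ! 3) \<and>
    (s = (0, 1, 0, 1) \<longrightarrow> coroot_list t ! 1 = coroot_list t ! 3)"

text \<open>Both orders are required because \<open>cliques\<close> tests each pair of roots only
  once.\<close>

definition adjacent :: "coords \<Rightarrow> coords \<Rightarrow> bool" where
  "adjacent s t \<longleftrightarrow> \<not> proportional_coords s t \<and> sigma1_coords s t \<and> sigma1_coords t s \<and>
    sigma2_coords s t \<and> sigma2_coords t s"

lemma adjacent_sym: "adjacent s t \<Longrightarrow> adjacent t s"
proof -
  have "proportional_coords s t \<longleftrightarrow> proportional_coords t s"
    unfolding proportional_coords_def by (intro ball_cong refl) (auto simp: mult.commute)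
  then show "adjacent s t \<Longrightarrow> adjacent t s" by (auto simp: adjacent_def)
qed

lemma axiom_Sigma1_iff:
  assumes "sys_roots X = vec_of ` T"
  shows "axiom_Sigma1 X \<longleftrightarrow> (\<forall>s \<in> T. \<forall>t \<in> T. s \<noteq> t \<longrightarrow> sigma1_coords s t)"
proof -
  have "(\<forall>\<sigma> \<in> vec_of ` T - {vec_of s}. even (coroot (bourbaki i) \<sigma>) \<and> coroot (bourbaki i) \<sigma> \<le> 0) \<longleftrightarrow>
      (\<forall>t \<in> T. s \<noteq> t \<longrightarrow> even (coroot_list t ! i) \<and> coroot_list t ! i \<le> 0)" if "i < 4" for i s
  proof -
    have "vec_of ` T - {vec_of s} = vec_of ` (T - {s})" by auto
    then show ?thesis using that by (auto simp: coroot_vec_of)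
  qed
  moreover have "vec_of s \<in> vec_of ` T \<longleftrightarrow> s \<in> T" for s
    by auto
  ultimately have "axiom_Sigma1 X \<longleftrightarrow> (\<forall>i < 4. double_list ! i \<in> T \<longrightarrow>
      (\<forall>t \<in> T. double_list ! i \<noteq> t \<longrightarrow> even (coroot_list t ! i) \<and> coroot_list t ! i \<le> 0))"
    unfolding axiom_Sigma1_def all_bourbaki assms by (simp add: double_root_bourbaki)
  then show ?thesis
    unfolding sigma1_coords_def set_upt atLeast0LessThan Ball_def lessThan_iff by blast
qed

text \<open>Testing distinct pairs is enough: on \<alpha> + \<beta> with \<alpha> and \<beta>
  orthogonal, both coroots have the value 2. So (\<Sigma>2) becomes a binary condition as needed for
  \<open>adjacent\<close>.\<close>

lemma axiom_Sigma2_iff: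
  assumes "sys_roots X = vec_of ` T"
  shows "axiom_Sigma2 X \<longleftrightarrow> (\<forall>s \<in> T. \<forall>t \<in> T. s \<noteq> t \<longrightarrow> sigma2_coords s t)"
proof -
  have coroot: "coroot 1 (vec_of t) = coroot_list t ! 0" "coroot 2 (vec_of t) = coroot_list t ! 1"
    "coroot 3 (vec_of t) = coroot_list t ! 2" "coroot 4 (vec_of t) = coroot_list t ! 3" for t
    using coroot_vec_of[of 0 t] coroot_vec_of[of 1 t] coroot_vec_of[of 2 t] coroot_vec_of[of 3 t]
    by (auto simp: bourbaki_def)
  \<comment> \<open>Of the sixteen index pairs only the six orthogonal ones, three up to order,
    survive.\<close>
  have pair: "(\<forall>i j. coroot i (\<alpha> j) = 0 \<and> \<alpha> i + \<alpha> j = vec_of s \<longrightarrow>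
      coroot i (vec_of t) = coroot j (vec_of t)) \<longleftrightarrow> sigma2_coords s t" for s t
    unfolding forall_4 sigma2_coords_def simple_root_vec_of coroot vec_of_add vec_of_inject
    by (simp only: coroot_list.simps nth_Cons_0) (simp, (blast | auto))
  have "axiom_Sigma2 X \<longleftrightarrow> (\<forall>s \<in> T. \<forall>t \<in> T. \<forall>i j. coroot i (\<alpha> j) = 0 \<and> \<alpha> i + \<alpha> j = vec_of s \<longrightarrow>
      coroot i (vec_of t) = coroot j (vec_of t))"
    unfolding axiom_Sigma2_def assms by blast
  then have "axiom_Sigma2 X \<longleftrightarrow> (\<forall>s \<in> T. \<forall>t \<in> T. sigma2_coords s t)"
    unfolding pair .
  moreover have "sigma2_coords s s" for s
    by (auto simp: sigma2_coords_def)
  ultimately show ?thesis by metis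
qed

section \<open>Spherical systems as finite data\<close>

text \<open>Keeping the order of \<open>root_list\<close> gives a canonical list, so equal sets of
  roots yield equal lists.\<close>

definition root_part :: "system_data \<Rightarrow> coords list" where
  "root_part X = filter (\<lambda>t. vec_of t \<in> sys_roots X) root_list"

definition p_part :: "system_data \<Rightarrow> bool list" where
  "p_part X = map (\<lambda>k. bourbaki k \<in> sys_p X) [0..<4]"

definition values_on :: "coords list \<Rightarrow> (root_lattice \<Rightarrow> int) \<Rightarrow> int list" where
  "values_on ss f = map (\<lambda>t. f (vec_of t)) ss"

text \<open>A multiset of value vectors forgets the labels of A but keeps multiplicities.\<close>

definition functional_part :: "system_data \<Rightarrow> int list multiset" where
  "functional_part X = image_mset (\<lambda>d. values_on (root_part X) (sys_c X d)) (mset_set (sys_A X))"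

definition invariant :: "system_data \<Rightarrow> (bool list \<times> coords list) \<times> int list multiset" where
  "invariant X = ((p_part X, root_part X), functional_part X)"

text \<open>Compatibility concerns single roots, so it is imposed on the vertices before the clique
  search.\<close>

definition bases :: "(bool list \<times> coords list) list" where
  "bases = concat (map (\<lambda>ps. map (Pair ps) (cliques adjacent (filter (compatible_coords ps) root_list)))
    (product_lists (replicate 4 [True, False])))"

lemma length_values_on [simp]: "length (values_on ss f) = length ss"
  by (simp add: values_on_def)

lemma values_on_nth [simp]: "j < length ss \<Longrightarrow> values_on ss f ! j = f (vec_of (ss ! j))"
  by (simp add: values_on_def)

lemma subset_of_p_part: "subset_of (p_part X) = sys_p X"
  unfolding set_eq_iff all_bourbaki by (simp add: bourbaki_in_subset_of p_part_def)

lemma p_part_eq_iff: "length ps = 4 \<Longrightarrow> p_part X = ps \<longleftrightarrow> sys_p X = subset_of ps"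
  unfolding set_eq_iff all_bourbaki
  by (auto simp: list_eq_iff_nth_eq p_part_def bourbaki_in_subset_of)

lemma distinct_root_part: "distinct (root_part X)"
  by (simp add: root_part_def distinct_root_list)

lemma sys_roots_root_part:
  assumes "sys_roots X \<subseteq> spherical_roots"
  shows "sys_roots X = vec_of ` set (root_part X)"
  using assms by (auto simp: spherical_roots_eq root_part_def)

lemma sys_rank_root_part:
  assumes "sys_roots X \<subseteq> spherical_roots"
  shows "sys_rank X = length (root_part X)"
  unfolding sys_rank_def sys_roots_root_part[OF assms]
  by (simp add: card_image inj_on_subset[OF inj_vec_of] distinct_card distinct_root_part)

lemma bases_iff:
  "(ps, ss) \<in> set bases \<longleftrightarrow> length ps = 4 \<and> ss \<in> set (subseqs root_list) \<and>
    (\<forall>t \<in> set ss. compatible_coords ps t) \<and>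
    (\<forall>s \<in> set ss. \<forall>t \<in> set ss. s \<noteq> t \<longrightarrow> adjacent s t)"
proof -
  have "ps \<in> set (product_lists (replicate 4 [True, False])) \<longleftrightarrow> length ps = 4"
    by (auto simp: product_lists_set list_all2_conv_all_nth)
  then have "(ps, ss) \<in> set bases \<longleftrightarrow> length ps = 4 \<and> ss \<in> set (subseqs root_list) \<and>
      (\<forall>t \<in> set ss. compatible_coords ps t) \<and> sorted_wrt adjacent ss"
    unfolding bases_def cliques_eq subseqs_filter by (auto simp: list_all_iff simp del: subseqs.simps)
  moreover have "sorted_wrt adjacent ss \<longleftrightarrow> (\<forall>s \<in> set ss. \<forall>t \<in> set ss. s \<noteq> t \<longrightarrow> adjacent s t)"
    if "ss \<in> set (subseqs root_list)"
    using subseqs_distinctD[OF that distinct_root_list] adjacent_sym by (rule sorted_wrt_symp)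
  ultimately show ?thesis by (metis (no_types, lifting))
qed

lemma root_axioms_iff:
  assumes "sys_roots X \<subseteq> spherical_roots"
  shows "(\<forall>\<sigma> \<in> sys_roots X. \<forall>\<tau> \<in> sys_roots X. \<sigma> \<noteq> \<tau> \<longrightarrow> \<not> proportional \<sigma> \<tau>) \<and>
      axiom_S X \<and> axiom_Sigma1 X \<and> axiom_Sigma2 X \<longleftrightarrow> (p_part X, root_part X) \<in> set bases"
proof -
  let ?T = "set (root_part X)"
  note roots = sys_roots_root_part[OF assms]
  \<comment> \<open>The criterion by minors is available for nonzero vectors.\<close>
  have "t \<noteq> (0, 0, 0, 0)" if "t \<in> ?T" for t
    using that zero_notin_root_list by (auto simp: root_part_def)
  then have prop_iff: "proportional (vec_of s) (vec_of t) \<longleftrightarrow> proportional_coords s t"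
    if "s \<in> ?T" "t \<in> ?T" for s t
    using that proportional_vec_of by blast
  have nonprop: "(\<forall>\<sigma> \<in> sys_roots X. \<forall>\<tau> \<in> sys_roots X. \<sigma> \<noteq> \<tau> \<longrightarrow> \<not> proportional \<sigma> \<tau>) \<longleftrightarrow>
      (\<forall>s \<in> ?T. \<forall>t \<in> ?T. s \<noteq> t \<longrightarrow> \<not> proportional_coords s t)"
    unfolding roots by (simp add: prop_iff)
  have S: "axiom_S X \<longleftrightarrow> (\<forall>t \<in> ?T. compatible_coords (p_part X) t)"
    unfolding axiom_S_def roots by (simp add: compatible_vec_of[symmetric] subset_of_p_part)
  have adjacent: "(\<forall>s \<in> ?T. \<forall>t \<in> ?T. s \<noteq> t \<longrightarrow> adjacent s t) \<longleftrightarrow>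
      (\<forall>s \<in> ?T. \<forall>t \<in> ?T. s \<noteq> t \<longrightarrow> \<not> proportional_coords s t) \<and> axiom_Sigma1 X \<and> axiom_Sigma2 X"
    (is "?L \<longleftrightarrow> ?R")
    unfolding axiom_Sigma1_iff[OF roots] axiom_Sigma2_iff[OF roots]
  proof (intro iffI conjI ballI impI)
    fix s t assume *: "s \<in> ?T" "t \<in> ?T" "s \<noteq> t"
    {
      assume ?L
      then have "adjacent s t" using * by blast
      then show "\<not> proportional_coords s t" "sigma1_coords s t" "sigma2_coords s t"
        by (simp_all add: adjacent_def)
    }
    assume "(\<forall>s \<in> ?T. \<forall>t \<in> ?T. s \<noteq> t \<longrightarrow> \<not> proportional_coords s t) \<and>
      (\<forall>s \<in> ?T. \<forall>t \<in> ?T. s \<noteq> t \<longrightarrow> sigma1_coords s t) \<and>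
      (\<forall>s \<in> ?T. \<forall>t \<in> ?T. s \<noteq> t \<longrightarrow> sigma2_coords s t)"
    then show "adjacent s t"
      unfolding adjacent_def using * *(3)[symmetric] by (intro conjI) blast+
  qed
  have "length (p_part X) = 4" "root_part X \<in> set (subseqs root_list)"
    by (simp_all add: p_part_def root_part_def filter_in_subseqs)
  then show ?thesis
    unfolding bases_iff nonprop S adjacent by (simp only: simp_thms conj_ac)
qed

lemma simple_root_in_sys_roots:
  assumes "sys_roots X \<subseteq> spherical_roots" "i < 4"
  shows "\<alpha> (bourbaki i) \<in> sys_roots X \<longleftrightarrow> (\<exists>k. (k, i) \<in> set (simple_positions (root_part X)))"
  unfolding sys_roots_root_part[OF assms(1)] simple_root_bourbaki[OF assms(2)]
  using assms(2) by (auto simp: inj_image_mem_iff[OF inj_vec_of] set_simple_positions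
      in_set_conv_nth[of _ "root_part X"])

text \<open>(A1)-(A3) evaluate functionals only at roots of \<Sigma>, hence depend only on value
  vectors. Labels enter (A2) only through the number of elements of A(\<alpha>), which the multiset
  records.\<close>

lemma functional_axioms_iff:
  assumes roots: "sys_roots X \<subseteq> spherical_roots" and fin: "finite (sys_A X)"
  shows "axiom_A1 X \<and> axiom_A2 X \<and> axiom_A3 X \<longleftrightarrow> valid_functionals (root_part X) (functional_part X)"
proof -
  let ?ss = "root_part X"
  let ?v = "\<lambda>d. values_on ?ss (sys_c X d)"
  note sys_roots = sys_roots_root_part[OF roots]
  have ball: "(\<forall>\<sigma> \<in> sys_roots X. P \<sigma>) \<longleftrightarrow> (\<forall>j < length ?ss. P (vec_of (?ss ! j)))" for P
    unfolding sys_roots by (simp add: all_set_conv_all_nth)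
  have "sys_c X d \<sigma> \<le> 1 \<and> (sys_c X d \<sigma> = 1 \<longrightarrow> \<sigma> \<in> range \<alpha> \<inter> sys_roots X) \<longleftrightarrow> sys_c X d \<sigma> \<le> upper t"
    if "\<sigma> = vec_of t" "\<sigma> \<in> sys_roots X" for d \<sigma> t
    using that by (auto simp: upper_def vec_of_in_range_simple)
  then have A1: "axiom_A1 X \<longleftrightarrow>
      (\<forall>d \<in> sys_A X. \<forall>j < length ?ss. sys_c X d (vec_of (?ss ! j)) \<le> upper (?ss ! j))"
    unfolding axiom_A1_def ball by (auto simp: sys_roots)
  have alpha: "\<alpha> (bourbaki i) = vec_of (?ss ! k)" if "(k, i) \<in> set (simple_positions ?ss)" for k i
    using that by (simp add: set_simple_positions simple_root_bourbaki)
  have A_of: "filter_mset (\<lambda>f. f ! k = 1) (functional_part X) = image_mset ?v (mset_set (A_of X (bourbaki i)))"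
    if "(k, i) \<in> set (simple_positions ?ss)" for k i
  proof -
    have "{d \<in> sys_A X. ?v d ! k = 1} = A_of X (bourbaki i)"
      using that by (auto simp: A_of_def alpha set_simple_positions)
    then show ?thesis
      using fin by (simp add: functional_part_def filter_mset_image_mset)
  qed
  have finite_A_of: "finite (A_of X i)" for i
    using fin by (simp add: A_of_def)
  have pair: "(\<exists>p q. p \<noteq> q \<and> A_of X (bourbaki i) = {p, q} \<and>
      (\<forall>\<sigma> \<in> sys_roots X. sys_c X p \<sigma> + sys_c X q \<sigma> = coroot (bourbaki i) \<sigma>)) \<longleftrightarrow>
      (\<exists>p q. filter_mset (\<lambda>f. f ! k = 1) (functional_part X) = {#p, q#} \<and>
        (\<forall>j < length ?ss. p ! j + q ! j = coroot_list (?ss ! j) ! i))" (is "?L \<longleftrightarrow> ?R")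
    if ki: "(k, i) \<in> set (simple_positions ?ss)" for k i
  proof -
    have i: "i < 4" using ki by (simp add: set_simple_positions)
    show ?thesis
    proof
      assume ?L
      then obtain p q where pq: "p \<noteq> q" "A_of X (bourbaki i) = {p, q}"
        and sum: "\<forall>j < length ?ss. sys_c X p (vec_of (?ss ! j)) + sys_c X q (vec_of (?ss ! j)) =
          coroot (bourbaki i) (vec_of (?ss ! j))"
        unfolding ball by blast
      then have "?v p ! j + ?v q ! j = coroot_list (?ss ! j) ! i" if "j < length ?ss" for j
        using that by (simp add: coroot_vec_of[OF i])
      moreover have "image_mset ?v (mset_set (A_of X (bourbaki i))) = {#?v p, ?v q#}"
        using pq by simp
      ultimately show ?R unfolding A_of[OF ki] by blast
    next
      assume ?R
      then obtain f g where fg: "image_mset ?v (mset_set (A_of X (bourbaki i))) = {#f, g#}"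
        "\<forall>j < length ?ss. f ! j + g ! j = coroot_list (?ss ! j) ! i"
        unfolding A_of[OF ki] by blast
      obtain p q where pq: "p \<noteq> q" "A_of X (bourbaki i) = {p, q}" and v: "?v p = f" "?v q = g"
        by (rule image_mset_set_eq_pair[OF finite_A_of fg(1)])
      have "sys_c X p (vec_of (?ss ! j)) + sys_c X q (vec_of (?ss ! j)) =
          coroot (bourbaki i) (vec_of (?ss ! j))" if "j < length ?ss" for j
        using that fg(2) unfolding v[symmetric] by (simp add: coroot_vec_of[OF i])
      then show ?L unfolding ball using pq by blast
    qed
  qed
  have A2: "axiom_A2 X \<longleftrightarrow> (\<forall>(k, i) \<in> set (simple_positions ?ss).
      \<exists>p q. filter_mset (\<lambda>f. f ! k = 1) (functional_part X) = {#p, q#} \<and>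
        (\<forall>j < length ?ss. p ! j + q ! j = coroot_list (?ss ! j) ! i))" (is "_ \<longleftrightarrow> ?R")
  proof
    assume A2: "axiom_A2 X"
    show ?R
    proof clarify
      fix k i assume ki: "(k, i) \<in> set (simple_positions ?ss)"
      then have "\<alpha> (bourbaki i) \<in> sys_roots X"
        using simple_root_in_sys_roots[OF roots] by (auto simp: set_simple_positions)
      then show "\<exists>p q. filter_mset (\<lambda>f. f ! k = 1) (functional_part X) = {#p, q#} \<and>
          (\<forall>j < length ?ss. p ! j + q ! j = coroot_list (?ss ! j) ! i)"
        using A2 pair[OF ki] unfolding axiom_A2_def by blast
    qed
  next
    assume R: ?R
    show "axiom_A2 X"
      unfolding axiom_A2_def all_bourbaki
    proof (intro allI impI)
      fix i :: nat assume "i < 4" "\<alpha> (bourbaki i) \<in> sys_roots X"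
      then obtain k where ki: "(k, i) \<in> set (simple_positions ?ss)"
        using simple_root_in_sys_roots[OF roots] by auto
      show "\<exists>p q. p \<noteq> q \<and> A_of X (bourbaki i) = {p, q} \<and>
          (\<forall>\<sigma> \<in> sys_roots X. sys_c X p \<sigma> + sys_c X q \<sigma> = coroot (bourbaki i) \<sigma>)"
        unfolding pair[OF ki] using bspec[OF R ki] by (simp only: prod.case)
    qed
  qed
  have "(\<exists>i. \<alpha> i \<in> sys_roots X \<and> sys_c X d (\<alpha> i) = 1) \<longleftrightarrow>
      (\<exists>(k, i) \<in> set (simple_positions ?ss). ?v d ! k = 1)" (is "?L \<longleftrightarrow> ?R") for d
  proof -
    have value_at: "sys_c X d (\<alpha> (bourbaki i)) = 1 \<longleftrightarrow> ?v d ! k = 1"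
      if "(k, i) \<in> set (simple_positions ?ss)" for k i
      unfolding alpha[OF that] using that by (simp add: set_simple_positions)
    have "?L \<longleftrightarrow> (\<exists>k i. (k, i) \<in> set (simple_positions ?ss) \<and> sys_c X d (\<alpha> (bourbaki i)) = 1)"
      unfolding ex_bourbaki[of "\<lambda>i. \<alpha> i \<in> sys_roots X \<and> sys_c X d (\<alpha> i) = 1"]
      using simple_root_in_sys_roots[OF roots] by (metis set_simple_positions)
    also have "\<dots> \<longleftrightarrow> ?R"
      unfolding Bex_def split_paired_Ex prod.case using value_at by blast
    finally show ?thesis .
  qed
  note simple_value = this
  \<comment> \<open>Only the inclusion of A in the union has content, since every A(\<alpha>) is a
    subset of A.\<close>
  have "axiom_A3 X \<longleftrightarrow> (\<forall>d \<in> sys_A X. \<exists>i. \<alpha> i \<in> sys_roots X \<and> sys_c X d (\<alpha> i) = 1)"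
    unfolding axiom_A3_def A_of_def by blast
  then have A3: "axiom_A3 X \<longleftrightarrow> (\<forall>d \<in> sys_A X. \<exists>(k, i) \<in> set (simple_positions ?ss). ?v d ! k = 1)"
    unfolding simple_value .
  have "set_mset (functional_part X) = ?v ` sys_A X"
    using fin by (simp add: functional_part_def)
  then have "valid_functionals ?ss (functional_part X) \<longleftrightarrow>
      (\<forall>d \<in> sys_A X. (\<forall>j < length ?ss. sys_c X d (vec_of (?ss ! j)) \<le> upper (?ss ! j)) \<and>
        (\<exists>(k, i) \<in> set (simple_positions ?ss). ?v d ! k = 1)) \<and> axiom_A2 X"
    unfolding valid_functionals_def A2 by simp
  then show ?thesis using A1 A3 by blast
qed

lemma spherical_system_iff:
  "spherical_system X \<longleftrightarrow> sys_roots X \<subseteq> spherical_roots \<and> finite (sys_A X) \<and>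
    (\<forall>d \<in> sys_A X. additive_on_closure (sys_roots X) (sys_c X d)) \<and>
    (p_part X, root_part X) \<in> set bases \<and> valid_functionals (root_part X) (functional_part X)"
proof (cases "sys_roots X \<subseteq> spherical_roots \<and> finite (sys_A X)")
  case True
  show ?thesis
    unfolding spherical_system_def root_axioms_iff[OF conjunct1[OF True], symmetric]
      functional_axioms_iff[OF conjunct1[OF True] conjunct2[OF True], symmetric]
    by (intro iffI; elim conjE; intro conjI; assumption)
next
  case False
  then show ?thesis unfolding spherical_system_def by argo
qed

section \<open>Isomorphism classes and their invariants\<close>

text \<open>Additivity on the lattice forces the value 0 at 0 and compatibility with differences, so
  agreement propagates from the generators.\<close>

lemma additive_on_closure_eq:
  assumes "additive_on_closure \<Gamma> f" "additive_on_closure \<Gamma> g" "\<And>x. x \<in> \<Gamma> \<Longrightarrow> f x = g x"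
    "x \<in> group_closure \<Gamma>"
  shows "f x = g x"
proof -
  have zero: "h 0 = 0" if "additive_on_closure \<Gamma> h" for h
    using that unfolding additive_on_closure_def by (metis add_cancel_right_right zero_in_group_closure)
  have minus: "h (x - y) = h x - h y"
    if h: "additive_on_closure \<Gamma> h" and xy: "x \<in> group_closure \<Gamma>" "y \<in> group_closure \<Gamma>" for h x y
  proof -
    have "h (x - y + y) = h (x - y) + h y"
      using h xy group_closure.diff[OF xy] unfolding additive_on_closure_def by blast
    then show ?thesis by simp
  qed
  show ?thesis
    using assms(4)
  proof (induction rule: group_closure.induct)
    \<comment> \<open>Besides the generators, 0 is a base element of
      \<open>group_closure\<close>.\<close>
    case (base s)
    then show ?case using assms(3) zero[OF assms(1)] zero[OF assms(2)] by auto
  next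
    case (diff s t)
    then show ?case using minus[OF assms(1)] minus[OF assms(2)] by simp
  qed
qed

text \<open>An isomorphism relabels A without changing value vectors. Conversely, equal multisets
  give a bijection matching value vectors on \<Sigma>, and additivity extends the match to the
  lattice generated by \<Sigma>.\<close>

lemma isomorphic_iff_invariant_eq:
  assumes X: "spherical_system X" and Y: "spherical_system Y"
  shows "isomorphic X Y \<longleftrightarrow> invariant X = invariant Y"
proof
  assume "isomorphic X Y"
  then obtain f where f: "sys_roots X = sys_roots Y" "sys_p X = sys_p Y" "bij_betw f (sys_A X) (sys_A Y)"
    "\<And>d x. d \<in> sys_A X \<Longrightarrow> x \<in> group_closure (sys_roots X) \<Longrightarrow> sys_c Y (f d) x = sys_c X d x"
    unfolding isomorphic_def by blast
  have ss: "root_part X = root_part Y" "p_part X = p_part Y"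
    by (simp_all add: root_part_def p_part_def f)
  have "sys_c Y (f d) (vec_of t) = sys_c X d (vec_of t)" if "d \<in> sys_A X" "t \<in> set (root_part X)" for d t
    using that by (intro f(4) group_closure.base) (auto simp: root_part_def)
  then have "values_on (root_part Y) (sys_c Y (f d)) = values_on (root_part X) (sys_c X d)"
    if "d \<in> sys_A X" for d
    using that ss by (simp add: values_on_def)
  moreover have "mset_set (sys_A Y) = image_mset f (mset_set (sys_A X))"
    using f(3) by (simp add: image_mset_mset_set bij_betw_def)
  ultimately have "functional_part X = functional_part Y"
    using X by (auto simp: functional_part_def spherical_system_def multiset.map_comp intro!: image_mset_cong)
  then show "invariant X = invariant Y" by (simp add: invariant_def ss)
next
  assume eq: "invariant X = invariant Y"
  let ?ss = "root_part X"
  have ss: "root_part Y = ?ss" using eq by (simp add: invariant_def)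
  have roots: "sys_roots X = vec_of ` set ?ss" "sys_roots Y = vec_of ` set ?ss"
    using sys_roots_root_part[of X] sys_roots_root_part[of Y] X Y ss
    unfolding spherical_system_def by metis+
  have p: "sys_p X = sys_p Y"
    using eq subset_of_p_part by (metis invariant_def prod.inject)
  have "image_mset (\<lambda>d. values_on ?ss (sys_c X d)) (mset_set (sys_A X)) =
      image_mset (\<lambda>d. values_on ?ss (sys_c Y d)) (mset_set (sys_A Y))"
    using eq ss by (simp add: invariant_def functional_part_def)
  then obtain f where f: "bij_betw f (sys_A X) (sys_A Y)"
    "\<And>d. d \<in> sys_A X \<Longrightarrow> values_on ?ss (sys_c Y (f d)) = values_on ?ss (sys_c X d)"
    using X Y by (elim image_mset_eq_obtain_bij_betw[rotated 2]) (auto simp: spherical_system_def)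
  have "sys_c Y (f d) x = sys_c X d x" if d: "d \<in> sys_A X" and x: "x \<in> group_closure (sys_roots X)" for d x
  proof (rule additive_on_closure_eq[OF _ _ _ x])
    have "f d \<in> sys_A Y" using d f(1) by (auto simp: bij_betw_def)
    moreover have "sys_roots X = sys_roots Y" by (simp only: roots)
    ultimately show "additive_on_closure (sys_roots X) (sys_c Y (f d))"
      using Y unfolding spherical_system_def by metis
    show "additive_on_closure (sys_roots X) (sys_c X d)"
      using X d unfolding spherical_system_def by blast
    show "sys_c Y (f d) y = sys_c X d y" if "y \<in> sys_roots X" for y
      using that f(2)[OF d] unfolding roots values_on_def by auto
  qed
  then show "isomorphic X Y"
    using f(1) roots p unfolding isomorphic_def by auto
qed

section \<open>Existence of systems with given data\<close>

definition pairing :: "coords \<Rightarrow> coords \<Rightarrow> int" where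
  "pairing w t = (\<Sum>(x, y) \<leftarrow> zip (coord_list w) (coord_list t). x * y)"

text \<open>Dual bases, up to scaling, of all the sets \<open>\<Sigma>\<close> that occur in a spherical system.\<close>

definition dual_vectors :: "coords list" where
  "dual_vectors = [(1, 0, 0, 0), (0, 1, 0, 0), (0, 0, 1, 0), (0, 0, 0, 1),
    (0, 1, -1, 0), (1, -1, 0, 1), (1, -1, 1, 0), (1, -1, 0, 0)]"

text \<open>This gives linear independence with an explicit dual family taken from a fixed list, so
  it can be decided by evaluation.\<close>

definition separated :: "coords list \<Rightarrow> bool" where
  "separated ss \<longleftrightarrow> (\<forall>t \<in> set ss. \<exists>w \<in> set dual_vectors.
    pairing w t \<noteq> 0 \<and> (\<forall>s \<in> set ss. s \<noteq> t \<longrightarrow> pairing w s = 0))"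

definition dual_form :: "coords \<Rightarrow> root_lattice \<Rightarrow> int" where
  "dual_form w x = (\<Sum>i \<in> UNIV. vec_of w $ i * x $ i)"

lemma dual_form_vec_of: "dual_form w (vec_of t) = pairing w t"
proof -
  have nth: "vec_of u $ 1 = coord_list u ! 0" "vec_of u $ 2 = coord_list u ! 1"
    "vec_of u $ 3 = coord_list u ! 2" "vec_of u $ 4 = coord_list u ! 3" for u
    using vec_of_nth[of 0 u] vec_of_nth[of 1 u] vec_of_nth[of 2 u] vec_of_nth[of 3 u]
    by (auto simp: bourbaki_def)
  show ?thesis
    by (cases w; cases t) (simp add: dual_form_def pairing_def sum_4 nth)
qed

lemma dual_form_diff: "dual_form w (x - y) = dual_form w x - dual_form w y"
  by (simp add: dual_form_def sum_subtractf right_diff_distrib)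

lemma dual_form_add: "dual_form w (x + y) = dual_form w x + dual_form w y"
  by (simp add: dual_form_def sum.distrib distrib_left)

text \<open>The extension is a combination of the coordinate functions relative to
  \<open>ss\<close>. Each coordinate is a dual form divided by its value on the corresponding
  root.\<close>

lemma additive_extension:
  assumes ss: "distinct ss" "separated ss" and len: "length f = length ss"
  shows "\<exists>g. additive_on_closure (vec_of ` set ss) g \<and> values_on ss g = f"
proof -
  obtain w where w: "\<And>t. t \<in> set ss \<Longrightarrow> pairing (w t) t \<noteq> 0"
    "\<And>s t. s \<in> set ss \<Longrightarrow> t \<in> set ss \<Longrightarrow> s \<noteq> t \<Longrightarrow> pairing (w t) s = 0"
    using ss(2) unfolding separated_def by metis
  \<comment> \<open>Integer division is exact, hence additive, on the lattice generated by
    \<open>ss\<close>; values elsewhere are irrelevant.\<close>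
  let ?e = "\<lambda>j x. dual_form (w (ss ! j)) x div pairing (w (ss ! j)) (ss ! j)"
  let ?g = "\<lambda>x. \<Sum>j < length ss. f ! j * ?e j x"
  \<comment> \<open>On generators the dual form is either 0 or its normalizing value.\<close>
  have dvd: "pairing (w t) t dvd dual_form (w t) x"
    if t: "t \<in> set ss" and x: "x \<in> group_closure (vec_of ` set ss)" for t x
    using x
  proof (induction rule: group_closure.induct)
    case (base s)
    then consider "s = 0" | u where "u \<in> set ss" "s = vec_of u" by auto
    then show ?case
    proof cases
      case 1
      then show ?thesis by (simp add: dual_form_def)
    next
      case 2
      then show ?thesis using w(2)[OF _ t, of u] by (cases "u = t") (simp_all add: dual_form_vec_of)
    qed
  qed (simp add: dual_form_diff)
  have "?e j (x + y) = ?e j x + ?e j y" if "j < length ss"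
    "x \<in> group_closure (vec_of ` set ss)" "y \<in> group_closure (vec_of ` set ss)" for j x y
    using that dvd by (simp add: dual_form_add div_plus_div_distrib_dvd_left)
  then have "additive_on_closure (vec_of ` set ss) ?g"
    unfolding additive_on_closure_def by (simp add: distrib_left sum.distrib)
  moreover have "?g (vec_of (ss ! k)) = f ! k" if k: "k < length ss" for k
  proof -
    have "?e j (vec_of (ss ! k)) = (if j = k then 1 else 0)" if "j < length ss" for j
      using that k w(1)[of "ss ! j"] w(2)[of "ss ! k" "ss ! j"] ss(1)
      by (auto simp: dual_form_vec_of nth_eq_iff_index_eq)
    then have "?g (vec_of (ss ! k)) = (\<Sum>j < length ss. if j = k then f ! j else 0)"
      by (intro sum.cong) auto
    then show ?thesis using k by simp
  qed
  then have "values_on ss ?g = f"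
    using len by (intro nth_equalityI) auto
  ultimately show ?thesis by blast
qed

lemma system_exists:
  assumes base: "(ps, ss) \<in> set bases" and M: "valid_functionals ss M" and sep: "separated ss"
  shows "\<exists>X. spherical_system X \<and> invariant X = ((ps, ss), M)"
proof -
  have ss: "ss \<in> set (subseqs root_list)" and ps: "length ps = 4"
    using base by (auto simp: bases_iff)
  note distinct = subseqs_distinctD[OF ss distinct_root_list]
  obtain fs where fs: "mset fs = M" using ex_mset by blast
  have "\<exists>g. additive_on_closure (vec_of ` set ss) g \<and> values_on ss g = f" if "f \<in> set fs" for f
  proof (rule additive_extension[OF distinct sep])
    have "f \<in># M" using that fs by (metis set_mset_mset)
    then show "length f = length ss" using M unfolding valid_functionals_def by blast
  qed
  then obtain ext where ext: "\<And>f. f \<in> set fs \<Longrightarrow> additive_on_closure (vec_of ` set ss) (ext f)"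
    "\<And>f. f \<in> set fs \<Longrightarrow> values_on ss (ext f) = f" by metis
  \<comment> \<open>Labels are positions in a listing of \<open>M\<close>, so repeated functionals
    receive different labels.\<close>
  define X where "X = \<lparr>sys_roots = vec_of ` set ss, sys_p = subset_of ps,
    sys_A = {..<length fs}, sys_c = (\<lambda>d. ext (fs ! d))\<rparr>"
  have "root_part X = ss"
    using filter_mem_subseq[OF distinct_root_list ss]
    by (simp add: root_part_def X_def inj_image_mem_iff[OF inj_vec_of])
  moreover have "p_part X = ps"
    using ps by (simp add: p_part_eq_iff X_def)
  moreover have "functional_part X = M"
  proof -
    have "functional_part X = image_mset (\<lambda>d. values_on ss (ext (fs ! d))) (mset_set {..<length fs})"
      using \<open>root_part X = ss\<close> by (simp add: functional_part_def X_def)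
    also have "\<dots> = image_mset ((!) fs) (mset_set {..<length fs})"
      by (intro image_mset_cong) (simp add: ext)
    also have "\<dots> = mset (map ((!) fs) [0..<length fs])"
      by (simp only: mset_map mset_upt lessThan_atLeast0)
    also have "\<dots> = M" by (simp add: map_nth fs)
    finally show ?thesis .
  qed
  moreover have "sys_roots X \<subseteq> spherical_roots"
    using set_subseqs_subset[OF ss] by (auto simp: X_def spherical_roots_eq)
  moreover have "finite (sys_A X)"
    by (simp add: X_def)
  moreover have "\<forall>d \<in> sys_A X. additive_on_closure (sys_roots X) (sys_c X d)"
    by (simp add: X_def ext)
  ultimately have "spherical_system X" "invariant X = ((ps, ss), M)"
    using base M unfolding spherical_system_iff invariant_def by (simp_all only: simp_thms)
  then show ?thesis by blast
qed

section \<open>Counting\<close>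

text \<open>A finite evaluation that provides both the bound 4 on the rank and the separation needed
  for existence. Nothing is claimed about bases without solutions, as they carry no system.\<close>

lemma solvable_bases:
  "\<forall>b \<in> set bases. solutions (snd b) = [] \<or> length (snd b) < 5 \<and> separated (snd b)"
  by code_simp

lemma distinct_concat_map_Pair:
  assumes "distinct xs" "\<And>x. distinct (f x)"
  shows "distinct (concat (map (\<lambda>x. map (Pair x) (f x)) xs))"
  using assms(1) by (induction xs) (auto simp: distinct_map inj_on_def assms(2))

lemma distinct_bases: "distinct bases"
  unfolding bases_def
proof (rule distinct_concat_map_Pair)
  show "distinct (product_lists (replicate 4 [True, False]))"
    by (rule distinct_product_lists) auto
  fix ps
  have "distinct (map set (subseqs (filter (compatible_coords ps) root_list)))"
    by (rule distinct_set_subseqs) (simp add: distinct_root_list)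
  then show "distinct (cliques adjacent (filter (compatible_coords ps) root_list))"
    unfolding cliques_eq by (auto simp: distinct_map)
qed

text \<open>Evaluation of the enumeration, with one entry for each rank from 0 to 4.\<close>

lemma solution_counts:
  "map (\<lambda>r. \<Sum>b \<leftarrow> filter (\<lambda>b. length (snd b) = r) bases. length (solutions (snd b))) [0..<5] =
    [16, 41, 61, 77, 71]"
  by code_simp

text \<open>Values are realized by \<open>system_exists\<close>; a base that is not separated has no
  valid multiset, so its fibre is empty. The predicate \<open>Q\<close> serves a single rank as well
  as all ranks at once.\<close>

lemma invariant_image:
  "invariant ` {X. spherical_system X \<and> Q (length (root_part X))} =
    (SIGMA b : {b \<in> set bases. Q (length (snd b))}. {M. valid_functionals (snd b) M})"
proof (intro equalityI subsetI)
  fix z assume "z \<in> invariant ` {X. spherical_system X \<and> Q (length (root_part X))}"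
  then show "z \<in> (SIGMA b : {b \<in> set bases. Q (length (snd b))}. {M. valid_functionals (snd b) M})"
    by (auto simp: invariant_def spherical_system_iff)
next
  fix z assume z: "z \<in> (SIGMA b : {b \<in> set bases. Q (length (snd b))}. {M. valid_functionals (snd b) M})"
  obtain ps ss M where [simp]: "z = ((ps, ss), M)" by (metis surj_pair)
  have base: "(ps, ss) \<in> set bases" and M: "valid_functionals ss M" and Q: "Q (length ss)"
    using z by auto
  have "solutions ss \<noteq> []" using solutions_complete[OF M] by auto
  then have "separated ss" using solvable_bases base by fastforce
  then obtain X where "spherical_system X" "invariant X = z"
    using system_exists[OF base M] by auto
  then show "z \<in> invariant ` {X. spherical_system X \<and> Q (length (root_part X))}"
    using Q by (auto simp: invariant_def intro!: image_eqI[of _ _ X])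
qed

text \<open>An isomorphism class is the fibre of \<open>invariant\<close> through any of its
  members, so classes correspond to values of \<open>invariant\<close>.\<close>

lemma card_quotient_invariant:
  assumes "S \<subseteq> {X. spherical_system X}"
  shows "card (S // iso_rel) = card (invariant ` S)"
proof -
  have "iso_rel `` {X} = {Y. spherical_system Y \<and> invariant X = invariant Y}" if "X \<in> S" for X
    using that assms isomorphic_iff_invariant_eq by (auto simp: iso_rel_def)
  then have "S // iso_rel = (\<lambda>v. {Y. spherical_system Y \<and> v = invariant Y}) ` invariant ` S"
    by (auto simp: quotient_def image_iff)
  \<comment> \<open>Each of these fibres contains a system, and a system determines its
    value.\<close>
  moreover have "inj_on (\<lambda>v. {Y. spherical_system Y \<and> v = invariant Y}) (invariant ` S)"
    using assms by (fastforce simp: inj_on_def)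
  ultimately show ?thesis by (simp add: card_image)
qed

text \<open>Adds up the sizes of the fibres over the bases; \<open>distinct_bases\<close> allows the
  sum to run along the list.\<close>

lemma card_systems:
  "card ({X. spherical_system X \<and> Q (length (root_part X))} // iso_rel) =
    (\<Sum>b \<leftarrow> filter (\<lambda>b. Q (length (snd b))) bases. length (solutions (snd b)))"
proof -
  have "card ({X. spherical_system X \<and> Q (length (root_part X))} // iso_rel) =
      card (SIGMA b : {b \<in> set bases. Q (length (snd b))}. {M. valid_functionals (snd b) M})"
    by (subst card_quotient_invariant) (auto simp: invariant_image)
  also have "\<dots> = (\<Sum>b \<in> set (filter (\<lambda>b. Q (length (snd b))) bases). length (solutions (snd b)))"
    by (subst card_SigmaI) (auto simp: valid_functionals_eq card_valid_functionals[unfolded valid_functionals_eq])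
  also have "\<dots> = (\<Sum>b \<leftarrow> filter (\<lambda>b. Q (length (snd b))) bases. length (solutions (snd b)))"
    by (rule sum_list_distinct_conv_sum_set[symmetric]) (simp add: distinct_bases)
  finally show ?thesis .
qed

lemma number_of_systems_of_rank_eq:
  "number_of_systems_of_rank r =
    (\<Sum>b \<leftarrow> filter (\<lambda>b. length (snd b) = r) bases. length (solutions (snd b)))"
proof -
  have "sys_rank X = length (root_part X)" if "spherical_system X" for X
    using that by (simp add: sys_rank_root_part spherical_system_def)
  then have "{X. spherical_system X \<and> sys_rank X = r} = {X. spherical_system X \<and> length (root_part X) = r}"
    by auto
  then show ?thesis
    unfolding number_of_systems_of_rank_def using card_systems[of "\<lambda>n. n = r"] by simp
qed

text \<open>Bases with five or more roots have no solutions, so they contribute 0 and the remaining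
  ones are grouped by rank.\<close>

lemma number_of_systems_eq: "number_of_systems = (\<Sum>r < 5. number_of_systems_of_rank r)"
proof -
  have "number_of_systems = (\<Sum>b \<leftarrow> bases. length (solutions (snd b)))"
    unfolding number_of_systems_def using card_systems[of "\<lambda>_. True"] by simp
  also have "\<dots> = (\<Sum>b \<in> set bases. length (solutions (snd b)))"
    by (rule sum_list_distinct_conv_sum_set[OF distinct_bases])
  also have "\<dots> = (\<Sum>b \<in> {b \<in> set bases. length (snd b) < 5}. length (solutions (snd b)))"
    using solvable_bases by (intro sum.mono_neutral_right) auto
  also have "\<dots> = (\<Sum>r < 5. \<Sum>b \<in> {b \<in> {b \<in> set bases. length (snd b) < 5}. length (snd b) = r}.
      length (solutions (snd b)))"
    by (rule sum.group[symmetric]) auto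
  also have "\<dots> = (\<Sum>r < 5. \<Sum>b \<in> set (filter (\<lambda>b. length (snd b) = r) bases). length (solutions (snd b)))"
    by (intro sum.cong) auto
  also have "\<dots> = (\<Sum>r < 5. number_of_systems_of_rank r)"
    unfolding number_of_systems_of_rank_eq
    by (intro sum.cong refl sum_list_distinct_conv_sum_set[symmetric]) (simp add: distinct_bases)
  finally show ?thesis .
qed

theorem mainTheorem2:
  shows "number_of_systems = 266 \<and>
    number_of_systems_of_rank 0 = 16 \<and>
    number_of_systems_of_rank 1 = 41 \<and>
    number_of_systems_of_rank 2 = 61 \<and>
    number_of_systems_of_rank 3 = 77 \<and>
    number_of_systems_of_rank 4 = 71"
proof -
  have "map number_of_systems_of_rank [0..<5] = [16, 41, 61, 77, 71]"
    unfolding number_of_systems_of_rank_eq using solution_counts .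
  then have ranks: "number_of_systems_of_rank 0 = 16" "number_of_systems_of_rank 1 = 41"
    "number_of_systems_of_rank 2 = 61" "number_of_systems_of_rank 3 = 77"
    "number_of_systems_of_rank 4 = 71"
    by (simp_all add: upt_conv_Cons numeral_eq_Suc)
  have "{..<5} = {0, 1, 2, 3, 4 :: nat}" by auto
  then show ?thesis
    using ranks by (simp add: number_of_systems_eq)
qed

end
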